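(* Let $\kappa>0$, $\alpha\in[0,2\pi)$, and let $\boldsymbol{n}:\mathbb{R}^2\to S^2\subset\mathbb{R}^3$ be twice continuously differentiable, with associated stereographic coordinate fields $w=\dfrac{n_1+in_2}{1+n_3}$ and $v=1/w$, valued in the Riemann sphere. Then: (1) For every compact subset $D\subset\mathbb{R}^2$, $$E_D[w]=4\pi\left(Q_D[w]+\Omega_D[w]\right)+\int_D 8\,\frac{\left(\partial_{\bar z}w-\frac i2\kappa e^{i\alpha}w^2\right)\left(\partial_z\bar w+\frac i2\kappa e^{-i\alpha}\bar w^2\right)}{(1+|w|^2)^2}\,\mathrm{d}x_1\,\mathrm{d}x_2 .$$ (2) The equality $E_D[w]=4\pi\left(Q_D[w]+\Omega_D[w]\right)$ holds for all compact $D\subset\mathbb{R}^2$ if and only if $v$ satisfies the Bogomol'nyi equation $$\partial_{\bar z}v=-\frac i2\kappa e^{i\alpha}.$$ (3) The general solution of this equation is $$v=-\frac i2\kappa e^{i\alpha}\bar z+f(z),$$ where $f$ is an arbitrary holomorphic map from the plane $\mathbb{C}\cong\mathbb{R}^2$ to the Riemann sphere.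
   Context: $(x_1,x_2)$ are Cartesian coordinates on $\mathbb{R}^2$, $\partial_i=\partial/\partial x_i$, $z=x_1+ix_2$, $\partial_z=\frac12(\partial_1-i\partial_2)$, $\partial_{\bar z}=\frac12(\partial_1+i\partial_2)$. The field is $\boldsymbol{n}=(n_1,n_2,n_3)^t$ with $n_1^2+n_2^2+n_3^2=1$; $\boldsymbol{e}_1,\boldsymbol{e}_2,\boldsymbol{e}_3$ is the canonical basis of $\mathbb{R}^3$. For an angle $\beta$, $R(\beta)$ is the rotation of $\mathbb{R}^3$ about the 3-axis by $\beta$, $\boldsymbol{e}_i^{\beta}=R(\beta)\boldsymbol{e}_i$, and $\boldsymbol{n}\cdot\nabla_{-\alpha}\times\boldsymbol{n}=\sum_{i=1}^2\boldsymbol{n}\cdot(\boldsymbol{e}_i^{-\alpha}\times\partial_i\boldsymbol{n})$. Also $\boldsymbol{n}^\alpha=R(\alpha)\boldsymbol{n}=(n_1^\alpha,n_2^\alpha,n_3^\alpha)^t$ and $(\nabla\boldsymbol{n})^2=|\partial_1\boldsymbol{n}|^2+|\partial_2\boldsymbol{n}|^2$. For compact $D\subset\mathbb{R}^2$ define $$E_D[\boldsymbol{n}]=\int_D\left(\tfrac12(\nabla\boldsymbol{n})^2+\kappa\,\boldsymbol{n}\cdot\nabla_{-\alpha}\times\boldsymbol{n}+\tfrac{\kappa^2}{2}(1-n_3)^2\right)\mathrm{d}x_1\,\mathrm{d}x_2,$$ $$Q_D[\boldsymbol{n}]=\frac1{4\pi}\int_D\boldsymbol{n}\cdot(\partial_1\boldsymbol{n}\times\partial_2\boldsymbol{n})\,\mathrm{d}x_1\,\mathrm{d}x_2,\qquad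 \Omega_D[\boldsymbol{n}]=\frac1{4\pi}\int_D\kappa(\partial_1n_2^\alpha-\partial_2n_1^\alpha)\,\mathrm{d}x_1\,\mathrm{d}x_2.$$ The stereographic coordinate $w$ (projection from the south pole) has inverse $n_1+in_2=\frac{2w}{1+|w|^2}$, $n_3=\frac{1-|w|^2}{1+|w|^2}$, with $w=\infty$ ($v=0$) at $\boldsymbol{n}=(0,0,-1)^t$ and $w=0$ ($v=\infty$) at $\boldsymbol{n}=(0,0,1)^t$. $E_D[w],Q_D[w],\Omega_D[w]$ denote $E_D[\boldsymbol{n}],Q_D[\boldsymbol{n}],\Omega_D[\boldsymbol{n}]$ expressed in terms of $w$. Conventions at infinite values: at points where $w=\infty$, the last integrand in (1) is understood through the coordinate $v$, where it reads $8\,|\partial_{\bar z}v+\frac i2\kappa e^{i\alpha}|^2/(1+|v|^2)^2$; at points where $v=\infty$, the equation $\partial_{\bar z}v=-\frac i2\kappa e^{i\alpha}$ is understood through $w$ as $\partial_{\bar z}w=\frac i2\kappa e^{i\alpha}w^2$. The holomorphic map $f$ may take the value $\infty$, and where $f=\infty$ the formula in (3) means $v=\infty$. *)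

theory Defs
  imports "HOL-Analysis.Analysis"
begin

definition partial :: "2 \<Rightarrow> (real^2 \<Rightarrow> 'a::real_normed_vector) \<Rightarrow> real^2 \<Rightarrow> 'a" where
  "partial i g x = vector_derivative (\<lambda>t. g (x + t *\<^sub>R axis i 1)) (at 0)"

definition zcoord :: "real^2 \<Rightarrow> complex" where
  "zcoord x = Complex (x$1) (x$2)"

definition dz :: "(real^2 \<Rightarrow> complex) \<Rightarrow> real^2 \<Rightarrow> complex" where
  "dz g x = (partial 1 g x - \<i> * partial 2 g x) / 2"

definition dzbar :: "(real^2 \<Rightarrow> complex) \<Rightarrow> real^2 \<Rightarrow> complex" where
  "dzbar g x = (partial 1 g x + \<i> * partial 2 g x) / 2"

text \<open>Continuity of the first derivative is implied by its differentiability.\<close>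

definition twice_cont_diff :: "('a::real_normed_vector \<Rightarrow> 'b::real_normed_vector) \<Rightarrow> bool" where
  "twice_cont_diff g \<longleftrightarrow>
     (\<exists>(g' :: 'a \<Rightarrow> 'a \<Rightarrow>\<^sub>L 'b) (g'' :: 'a \<Rightarrow> 'a \<Rightarrow>\<^sub>L ('a \<Rightarrow>\<^sub>L 'b)).
        (\<forall>x. (g has_derivative blinfun_apply (g' x)) (at x)) \<and>
        (\<forall>x. (g' has_derivative blinfun_apply (g'' x)) (at x)) \<and>
        continuous_on UNIV g'')"

definition sphere_field :: "(real^2 \<Rightarrow> real^3) \<Rightarrow> bool" where
  "sphere_field n \<longleftrightarrow>
     twice_cont_diff n \<and> (\<forall>x. (n x $ 1)\<^sup>2 + (n x $ 2)\<^sup>2 + (n x $ 3)\<^sup>2 = 1)"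

definition rot3 :: "real \<Rightarrow> real^3 \<Rightarrow> real^3" where
  "rot3 b u = vector [cos b * u$1 - sin b * u$2, sin b * u$1 + cos b * u$2, u$3]"

text \<open>The twisted curl term: the basis vectors \<open>e\<^sub>i\<close> are rotated by \<open>-\<alpha>\<close>.\<close>

definition dmi_density :: "real \<Rightarrow> (real^2 \<Rightarrow> real^3) \<Rightarrow> real^2 \<Rightarrow> real" where
  "dmi_density \<alpha> n x =
     n x \<bullet> cross3 (rot3 (-\<alpha>) (axis 1 1)) (partial 1 n x) +
     n x \<bullet> cross3 (rot3 (-\<alpha>) (axis 2 1)) (partial 2 n x)"

definition energy :: "real \<Rightarrow> real \<Rightarrow> (real^2) set \<Rightarrow> (real^2 \<Rightarrow> real^3) \<Rightarrow> real" where
  "energy \<kappa> \<alpha> D n =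
     (LINT x:D|lborel.
        ((norm (partial 1 n x))\<^sup>2 + (norm (partial 2 n x))\<^sup>2) / 2
        + \<kappa> * dmi_density \<alpha> n x + \<kappa>\<^sup>2 / 2 * (1 - n x $ 3)\<^sup>2)"

definition charge :: "(real^2) set \<Rightarrow> (real^2 \<Rightarrow> real^3) \<Rightarrow> real" where
  "charge D n =
     1 / (4 * pi) * (LINT x:D|lborel. n x \<bullet> cross3 (partial 1 n x) (partial 2 n x))"

definition vorticity :: "real \<Rightarrow> real \<Rightarrow> (real^2) set \<Rightarrow> (real^2 \<Rightarrow> real^3) \<Rightarrow> real" where
  "vorticity \<kappa> \<alpha> D n =
     1 / (4 * pi) * (LINT x:D|lborel.
        \<kappa> * (partial 1 (\<lambda>y. rot3 \<alpha> (n y) $ 2) x - partial 2 (\<lambda>y. rot3 \<alpha> (n y) $ 1) x))"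

datatype riemann_sphere = Fin complex | Infty

text \<open>The value at \<open>Infty\<close> is a dummy: \<open>fin_part\<close> is only meaningful as the chart on
  the complement of \<open>Infty\<close>.\<close>

fun fin_part :: "riemann_sphere \<Rightarrow> complex" where
  "fin_part (Fin a) = a"
| "fin_part Infty = 0"

fun sphere_inverse :: "riemann_sphere \<Rightarrow> riemann_sphere" where
  "sphere_inverse (Fin a) = (if a = 0 then Infty else Fin (1 / a))"
| "sphere_inverse Infty = Fin 0"

fun sphere_translate :: "complex \<Rightarrow> riemann_sphere \<Rightarrow> riemann_sphere" where
  "sphere_translate c (Fin a) = Fin (c + a)"
| "sphere_translate c Infty = Infty"

text \<open>Holomorphic maps into the Riemann sphere, in the charts \<open>fin_part\<close> and
  \<open>fin_part \<circ> sphere_inverse\<close>. The constant map \<open>Infty\<close> is included.\<close>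

definition sphere_holomorphic :: "(complex \<Rightarrow> riemann_sphere) \<Rightarrow> bool" where
  "sphere_holomorphic f \<longleftrightarrow>
     (\<forall>z. \<exists>U. open U \<and> z \<in> U \<and>
        ((\<forall>u\<in>U. f u \<noteq> Infty) \<and> (\<lambda>u. fin_part (f u)) holomorphic_on U \<or>
         (\<forall>u\<in>U. f u \<noteq> Fin 0) \<and> (\<lambda>u. fin_part (sphere_inverse (f u))) holomorphic_on U))"

text \<open>On the unit sphere, \<open>u$3 = -1\<close> holds only at the south pole.\<close>

definition stereo_w :: "real^3 \<Rightarrow> riemann_sphere" where
  "stereo_w u =
     (if u$3 = -1 then Infty else Fin (Complex (u$1) (u$2) / complex_of_real (1 + u$3)))"

definition stereo_v :: "real^3 \<Rightarrow> riemann_sphere" where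
  "stereo_v u = sphere_inverse (stereo_w u)"

text \<open>The remainder integrand for a field \<open>w\<close>; where \<open>w\<close> is infinite, it is read in the
  coordinate \<open>v = 1/w\<close>.\<close>

definition remainder_density ::
    "real \<Rightarrow> real \<Rightarrow> (real^2 \<Rightarrow> riemann_sphere) \<Rightarrow> real^2 \<Rightarrow> complex" where
  "remainder_density \<kappa> \<alpha> w x =
     (let wc = (\<lambda>y. fin_part (w y));
          vc = (\<lambda>y. fin_part (sphere_inverse (w y)))
      in if w x \<noteq> Infty then
           8 * ((dzbar wc x - \<i> / 2 * of_real \<kappa> * exp (\<i> * of_real \<alpha>) * (wc x)\<^sup>2) *
                (dz (\<lambda>y. cnj (wc y)) x + \<i> / 2 * of_real \<kappa> * exp (- \<i> * of_real \<alpha>) * (cnj (wc x))\<^sup>2))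
             / of_real ((1 + (cmod (wc x))\<^sup>2)\<^sup>2)
         else
           of_real (8 * (cmod (dzbar vc x + \<i> / 2 * of_real \<kappa> * exp (\<i> * of_real \<alpha>)))\<^sup>2
             / (1 + (cmod (vc x))\<^sup>2)\<^sup>2))"

text \<open>The Bogomol'nyi equation for a field \<open>v\<close>; where \<open>v\<close> is infinite, it is read in the
  coordinate \<open>w = 1/v\<close>.\<close>

definition bogomolnyi :: "real \<Rightarrow> real \<Rightarrow> (real^2 \<Rightarrow> riemann_sphere) \<Rightarrow> bool" where
  "bogomolnyi \<kappa> \<alpha> v \<longleftrightarrow>
     (let vc = (\<lambda>y. fin_part (v y));
          wc = (\<lambda>y. fin_part (sphere_inverse (v y)))
      in \<forall>x. if v x \<noteq> Infty
             then dzbar vc x = - (\<i> / 2) * of_real \<kappa> * exp (\<i> * of_real \<alpha>)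
             else dzbar wc x = \<i> / 2 * of_real \<kappa> * exp (\<i> * of_real \<alpha>) * (wc x)\<^sup>2)"

end

theory Submission
  imports Defs "HOL-Complex_Analysis.Cauchy_Integral_Formula"
begin

text \<open>At a point where \<open>w\<close> is finite, put \<open>t = 1 / (1 + n\<^sub>3)\<close>; then \<open>w = t (n\<^sub>1 + i n\<^sub>2)\<close> and
  \<open>1 + |w|\<^sup>2 = 2 t\<close>, and the energy density minus the charge and vorticity densities equals the
  nonnegative remainder modulo the polynomial relations \<open>t (1 + n\<^sub>3) = 1\<close>, \<open>n \<bullet> n = 1\<close> and
  \<open>n \<bullet> \<partial>\<^sub>i n = 0\<close>. In particular the remainder is continuous across the south pole, so its
  integrals over all compact sets vanish only if it vanishes identically, which is the
  Bogomol'nyi equation. Writing \<open>c\<close> for the right-hand side of that equation and \<open>z\<^sup>*\<close> for the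
  conjugate of \<open>z\<close>, the function \<open>f = v - c z\<^sup>*\<close> solves the Cauchy-Riemann equation; near a pole
  of \<open>v\<close> the same holds for \<open>1 / f = w / (1 - c z\<^sup>* w)\<close>. Conversely a solution
  given by \<open>f\<close> is locally a ratio \<open>p / q\<close> of smooth functions without common zeros, which
  makes the corresponding field on the sphere smooth.\<close>

subsection \<open>Wirtinger derivatives\<close>

text \<open>The real derivative of \<open>g\<close> at \<open>x\<close> written as
  \<open>A dz + B dzbar\<close>. Every real-linear map from the plane to the complex numbers has
  this form, so the predicate asks for real differentiability only, and \<open>B = 0\<close> is the
  Cauchy-Riemann equation.\<close>

definition has_wirtinger :: "(real^2 \<Rightarrow> complex) \<Rightarrow> complex \<Rightarrow> complex \<Rightarrow> real^2 \<Rightarrow> bool" where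
  "has_wirtinger g A B x \<longleftrightarrow>
     (g has_derivative (\<lambda>h. A * zcoord h + B * cnj (zcoord h))) (at x)"

lemma bounded_linear_zcoord: "bounded_linear zcoord"
proof -
  have "linear zcoord"
    by (rule linearI) (auto simp: zcoord_def complex_eq_iff)
  then show ?thesis by (simp add: linear_conv_bounded_linear)
qed

lemmas zcoord_has_derivative [derivative_intros] =
  bounded_linear.has_derivative[OF bounded_linear_zcoord]
lemmas continuous_on_zcoord [continuous_intros] =
  bounded_linear.continuous_on[OF bounded_linear_zcoord]

lemma zcoord_axis [simp]: "zcoord (axis 1 1) = 1" "zcoord (axis 2 1) = \<i>"
  by (auto simp: zcoord_def axis_def complex_eq_iff)

lemma zcoord_decompose: "h = Re (zcoord h) *\<^sub>R axis 1 1 + Im (zcoord h) *\<^sub>R axis 2 1"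
  by (simp add: vec_eq_iff forall_2 zcoord_def axis_def)

lemma partial_eqI:
  assumes "(g has_derivative g') (at x)"
  shows "partial i g x = g' (axis i 1)"
proof -
  interpret g': bounded_linear g' by (rule has_derivative_bounded_linear[OF assms])
  have "((\<lambda>t. x + t *\<^sub>R axis i 1) has_derivative (\<lambda>t. t *\<^sub>R axis i 1)) (at (0::real))"
    by (auto intro!: derivative_eq_intros)
  moreover have "(g has_derivative g') (at (x + 0 *\<^sub>R axis i 1))" using assms by simp
  ultimately have "((\<lambda>t. g (x + t *\<^sub>R axis i 1)) has_derivative (\<lambda>t. g' (t *\<^sub>R axis i 1))) (at (0::real))"
    by (rule has_derivative_compose)
  then have "((\<lambda>t. g (x + t *\<^sub>R axis i 1)) has_vector_derivative g' (axis i 1)) (at (0::real))"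
    by (simp add: has_vector_derivative_def g'.scaleR)
  then show ?thesis unfolding partial_def by (rule vector_derivative_at)
qed

lemma differentiable_bounded_linear:
  "bounded_linear L \<Longrightarrow> g differentiable F \<Longrightarrow> (\<lambda>x. L (g x)) differentiable F"
  unfolding differentiable_def by (blast intro: bounded_linear.has_derivative)

lemma partial_bounded_linear:
  assumes "bounded_linear L" "g differentiable (at x)"
  shows "partial i (\<lambda>y. L (g y)) x = L (partial i g x)"
proof -
  obtain g' where g': "(g has_derivative g') (at x)"
    using assms(2) by (auto simp: differentiable_def)
  show ?thesis
    using partial_eqI[OF g'] partial_eqI[OF bounded_linear.has_derivative[OF assms(1) g']] by simp
qed

lemma has_wirtinger_dz:
  assumes "has_wirtinger g A B x"
  shows "dz g x = A" "dzbar g x = B"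
proof -
  note d = assms[unfolded has_wirtinger_def]
  show "dz g x = A" "dzbar g x = B"
    unfolding dz_def dzbar_def partial_eqI[OF d] by (simp_all add: algebra_simps)
qed

text \<open>A real-linear map of the plane is determined by its values on the two axis vectors, and
  \<open>dz\<close> and \<open>dzbar\<close> are the combinations of these values that reproduce
  it.\<close>

lemma has_wirtinger_partial:
  assumes "g differentiable (at x)"
  shows "has_wirtinger g (dz g x) (dzbar g x) x"
proof -
  obtain g' where g': "(g has_derivative g') (at x)"
    using assms by (auto simp: differentiable_def)
  interpret g': bounded_linear g' by (rule has_derivative_bounded_linear[OF g'])
  have "g' h = dz g x * zcoord h + dzbar g x * cnj (zcoord h)" for h
  proof -
    have "g' h = Re (zcoord h) *\<^sub>R g' (axis 1 1) + Im (zcoord h) *\<^sub>R g' (axis 2 1)"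
      by (subst zcoord_decompose) (simp only: g'.add g'.scaleR)
    also have "\<dots> = dz g x * zcoord h + dzbar g x * cnj (zcoord h)"
      by (simp add: dz_def dzbar_def partial_eqI[OF g'] complex_eq_iff field_simps)
    finally show ?thesis .
  qed
  then have "g' = (\<lambda>h. dz g x * zcoord h + dzbar g x * cnj (zcoord h))" by blast
  with g' show ?thesis by (simp add: has_wirtinger_def)
qed

lemma has_wirtinger_const: "has_wirtinger (\<lambda>x. c) 0 0 x"
  by (simp add: has_wirtinger_def)

lemma has_wirtinger_cnj_zcoord: "has_wirtinger (\<lambda>x. cnj (zcoord x)) 0 1 x"
  unfolding has_wirtinger_def by (auto intro!: derivative_eq_intros has_derivative_cnj)

lemma has_wirtinger_cnj:
  "has_wirtinger f A B x \<Longrightarrow> has_wirtinger (\<lambda>x. cnj (f x)) (cnj B) (cnj A) x"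
  unfolding has_wirtinger_def
  by (drule has_derivative_cnj) (simp add: algebra_simps)

lemma has_wirtinger_add:
  "has_wirtinger f A B x \<Longrightarrow> has_wirtinger g A' B' x \<Longrightarrow>
   has_wirtinger (\<lambda>x. f x + g x) (A + A') (B + B') x"
  unfolding has_wirtinger_def
  by (drule (1) has_derivative_add) (simp add: algebra_simps)

lemma has_wirtinger_minus:
  "has_wirtinger f A B x \<Longrightarrow> has_wirtinger (\<lambda>x. - f x) (- A) (- B) x"
  unfolding has_wirtinger_def
  by (drule has_derivative_minus) (simp add: algebra_simps)

lemma has_wirtinger_mult:
  "has_wirtinger f A B x \<Longrightarrow> has_wirtinger g A' B' x \<Longrightarrow>
   has_wirtinger (\<lambda>x. f x * g x) (A * g x + f x * A') (B * g x + f x * B') x"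
  unfolding has_wirtinger_def
  by (drule (1) has_derivative_mult) (simp add: algebra_simps)

text \<open>The derivative of the outer function is complex-linear, so the chain rule multiplies
  both coefficients by \<open>F'\<close>.\<close>

lemma has_wirtinger_compose:
  assumes "(F has_field_derivative F') (at (g x))" "has_wirtinger g A B x"
  shows "has_wirtinger (\<lambda>x. F (g x)) (F' * A) (F' * B) x"
  using has_derivative_compose[OF assms(2)[unfolded has_wirtinger_def]
      assms(1)[unfolded has_field_derivative_def]]
  by (simp add: has_wirtinger_def algebra_simps)

lemma has_wirtinger_inverse:
  "has_wirtinger f A B x \<Longrightarrow> f x \<noteq> 0 \<Longrightarrow>
   has_wirtinger (\<lambda>x. inverse (f x)) (- (A / (f x)\<^sup>2)) (- (B / (f x)\<^sup>2)) x"
  using has_wirtinger_compose[of inverse "- (1 / (f x)\<^sup>2)" f x A B]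
    DERIV_inverse[of "f x" UNIV]
  by (simp add: power2_eq_square divide_inverse algebra_simps)

lemma has_wirtinger_zcoord_compose:
  assumes "(F has_field_derivative F') (at (zcoord x))"
  shows "has_wirtinger (\<lambda>x. F (zcoord x)) F' 0 x"
proof -
  have "has_wirtinger zcoord 1 0 x"
    unfolding has_wirtinger_def by (auto intro!: derivative_eq_intros)
  from has_wirtinger_compose[OF assms this] show ?thesis by simp
qed

lemma has_wirtinger_cong:
  assumes "has_wirtinger f A B x" "open S" "x \<in> S" "\<And>y. y \<in> S \<Longrightarrow> f y = g y"
  shows "has_wirtinger g A B x"
  using assms has_derivative_transform_within_open unfolding has_wirtinger_def by blast

lemma has_wirtinger_isCont: "has_wirtinger f A B x \<Longrightarrow> isCont f x"
  unfolding has_wirtinger_def by (rule has_derivative_continuous)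

subsection \<open>Continuous differentiability\<close>

text \<open>Continuity is imposed on \<open>dz g\<close> and \<open>dzbar g\<close>, which are again
  complex functions on the plane. The condition can therefore be iterated in \<open>C2_on\<close>,
  and sum, product and quotient rules stay within one type of function.\<close>

definition C1_on :: "(real^2) set \<Rightarrow> (real^2 \<Rightarrow> complex) \<Rightarrow> bool" where
  "C1_on S g \<longleftrightarrow> (\<forall>x\<in>S. has_wirtinger g (dz g x) (dzbar g x) x) \<and>
     continuous_on S (dz g) \<and> continuous_on S (dzbar g)"

definition C2_on :: "(real^2) set \<Rightarrow> (real^2 \<Rightarrow> complex) \<Rightarrow> bool" where
  "C2_on S g \<longleftrightarrow> (\<forall>x\<in>S. has_wirtinger g (dz g x) (dzbar g x) x) \<and>
     C1_on S (dz g) \<and> C1_on S (dzbar g)"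

lemma C1_onI:
  assumes "\<And>x. x \<in> S \<Longrightarrow> has_wirtinger g (A x) (B x) x" "continuous_on S A" "continuous_on S B"
  shows "C1_on S g"
proof -
  have *: "dz g x = A x" "dzbar g x = B x" if "x \<in> S" for x
    using has_wirtinger_dz[OF assms(1)[OF that]] by auto
  have "continuous_on S (dz g) = continuous_on S A" "continuous_on S (dzbar g) = continuous_on S B"
    by (intro continuous_on_cong; simp add: *)+
  with assms * show ?thesis by (simp add: C1_on_def)
qed

lemma C1_on_cong:
  assumes "C1_on S f" "open S" "\<And>y. y \<in> S \<Longrightarrow> f y = g y"
  shows "C1_on S g"
proof (rule C1_onI)
  show "has_wirtinger g (dz f x) (dzbar f x) x" if "x \<in> S" for x
    using assms that has_wirtinger_cong unfolding C1_on_def by blast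
qed (use assms in \<open>auto simp: C1_on_def\<close>)

text \<open>The functions \<open>dz g\<close> and \<open>A\<close> agree on \<open>S\<close>, and so
  do \<open>dzbar g\<close> and \<open>B\<close>. Openness of \<open>S\<close> carries this
  agreement over to their own derivatives.\<close>

lemma C2_onI:
  assumes "\<And>x. x \<in> S \<Longrightarrow> has_wirtinger g (A x) (B x) x" "C1_on S A" "C1_on S B" "open S"
  shows "C2_on S g"
proof -
  have *: "dz g x = A x" "dzbar g x = B x" if "x \<in> S" for x
    using has_wirtinger_dz[OF assms(1)[OF that]] by auto
  have "C1_on S (dz g)" "C1_on S (dzbar g)"
    using C1_on_cong assms(2-4) * by metis+
  with assms * show ?thesis by (simp add: C2_on_def)
qed

lemma C2_on_cong:
  assumes "C2_on S f" "open S" "\<And>y. y \<in> S \<Longrightarrow> f y = g y"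
  shows "C2_on S g"
proof (rule C2_onI)
  show "has_wirtinger g (dz f x) (dzbar f x) x" if "x \<in> S" for x
    using assms that has_wirtinger_cong unfolding C2_on_def by blast
qed (use assms in \<open>auto simp: C2_on_def\<close>)

lemma C1_on_imp_continuous_on: "C1_on S g \<Longrightarrow> continuous_on S g"
  unfolding C1_on_def
  by (intro continuous_at_imp_continuous_on ballI) (blast intro: has_wirtinger_isCont)

lemma C2_on_imp_C1_on: "C2_on S g \<Longrightarrow> C1_on S g"
  by (simp add: C2_on_def C1_on_def[of S g] C1_on_imp_continuous_on)

lemma C1_on_const: "C1_on S (\<lambda>x. c)"
  by (rule C1_onI[of _ _ "\<lambda>x. 0" "\<lambda>x. 0"]) (auto intro: has_wirtinger_const)

lemma C2_on_const: "open S \<Longrightarrow> C2_on S (\<lambda>x. c)"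
  by (rule C2_onI[of _ _ "\<lambda>x. 0" "\<lambda>x. 0"]) (auto intro: has_wirtinger_const C1_on_const)

lemma C1_on_cnj: "C1_on S f \<Longrightarrow> C1_on S (\<lambda>x. cnj (f x))"
  by (rule C1_onI[of _ _ "\<lambda>x. cnj (dzbar f x)" "\<lambda>x. cnj (dz f x)"])
    (auto intro: has_wirtinger_cnj continuous_on_cnj simp: C1_on_def)

lemma C2_on_cnj: "open S \<Longrightarrow> C2_on S f \<Longrightarrow> C2_on S (\<lambda>x. cnj (f x))"
  by (rule C2_onI[of _ _ "\<lambda>x. cnj (dzbar f x)" "\<lambda>x. cnj (dz f x)"])
    (auto intro: has_wirtinger_cnj C1_on_cnj simp: C2_on_def)

lemma C2_on_cnj_zcoord: "open S \<Longrightarrow> C2_on S (\<lambda>x. cnj (zcoord x))"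
  by (rule C2_onI[of _ _ "\<lambda>x. 0" "\<lambda>x. 1"]) (auto intro: has_wirtinger_cnj_zcoord C1_on_const)

lemma C1_on_add: "C1_on S f \<Longrightarrow> C1_on S g \<Longrightarrow> C1_on S (\<lambda>x. f x + g x)"
  by (rule C1_onI[of _ _ "\<lambda>x. dz f x + dz g x" "\<lambda>x. dzbar f x + dzbar g x"])
    (auto intro: has_wirtinger_add continuous_on_add simp: C1_on_def)

lemma C2_on_add: "open S \<Longrightarrow> C2_on S f \<Longrightarrow> C2_on S g \<Longrightarrow> C2_on S (\<lambda>x. f x + g x)"
  by (rule C2_onI[of _ _ "\<lambda>x. dz f x + dz g x" "\<lambda>x. dzbar f x + dzbar g x"])
    (auto intro: has_wirtinger_add C1_on_add simp: C2_on_def)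

lemma C1_on_minus: "C1_on S f \<Longrightarrow> C1_on S (\<lambda>x. - f x)"
  by (rule C1_onI[of _ _ "\<lambda>x. - dz f x" "\<lambda>x. - dzbar f x"])
    (auto intro: has_wirtinger_minus continuous_on_minus simp: C1_on_def)

lemma C2_on_minus: "open S \<Longrightarrow> C2_on S f \<Longrightarrow> C2_on S (\<lambda>x. - f x)"
  by (rule C2_onI[of _ _ "\<lambda>x. - dz f x" "\<lambda>x. - dzbar f x"])
    (auto intro: has_wirtinger_minus C1_on_minus simp: C2_on_def)

lemma C1_on_mult: "C1_on S f \<Longrightarrow> C1_on S g \<Longrightarrow> C1_on S (\<lambda>x. f x * g x)"
  by (rule C1_onI[of _ _ "\<lambda>x. dz f x * g x + f x * dz g x" "\<lambda>x. dzbar f x * g x + f x * dzbar g x"])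
    (auto intro!: has_wirtinger_mult continuous_on_add continuous_on_mult
       intro: C1_on_imp_continuous_on simp: C1_on_def[of S f] C1_on_def[of S g])

lemma C2_on_mult:
  assumes "open S" "C2_on S f" "C2_on S g"
  shows "C2_on S (\<lambda>x. f x * g x)"
  using assms C2_on_imp_C1_on[OF assms(2)] C2_on_imp_C1_on[OF assms(3)]
  by (intro C2_onI[of _ _ "\<lambda>x. dz f x * g x + f x * dz g x" "\<lambda>x. dzbar f x * g x + f x * dzbar g x"])
    (auto intro!: has_wirtinger_mult C1_on_add C1_on_mult simp: C2_on_def)

lemma C1_on_inverse:
  assumes "C1_on S f" "\<And>x. x \<in> S \<Longrightarrow> f x \<noteq> 0"
  shows "C1_on S (\<lambda>x. inverse (f x))"
  using assms C1_on_imp_continuous_on[OF assms(1)]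
  by (intro C1_onI[of _ _ "\<lambda>x. - (dz f x / (f x)\<^sup>2)" "\<lambda>x. - (dzbar f x / (f x)\<^sup>2)"])
    (auto intro!: has_wirtinger_inverse continuous_intros simp: C1_on_def)

lemma C2_on_inverse:
  assumes "open S" "C2_on S f" "\<And>x. x \<in> S \<Longrightarrow> f x \<noteq> 0"
  shows "C2_on S (\<lambda>x. inverse (f x))"
proof -
  have *: "C1_on S (\<lambda>x. - (A x / (f x)\<^sup>2))" if "C1_on S A" for A
    using assms C2_on_imp_C1_on[OF assms(2)] that unfolding divide_inverse
    by (intro C1_on_mult C1_on_minus C1_on_inverse) (auto simp: power2_eq_square intro: C1_on_mult)
  show ?thesis
    using assms
    by (intro C2_onI[of _ _ "\<lambda>x. - (dz f x / (f x)\<^sup>2)" "\<lambda>x. - (dzbar f x / (f x)\<^sup>2)"] *)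
      (auto intro!: has_wirtinger_inverse simp: C2_on_def)
qed

lemma open_vimage_zcoord: "open V \<Longrightarrow> open (zcoord -` V)"
  by (rule open_vimage) (auto intro: continuous_on_zcoord[OF continuous_on_id])

lemma C1_on_holomorphic:
  assumes "open V" "F holomorphic_on V"
  shows "C1_on (zcoord -` V) (\<lambda>x. F (zcoord x))"
proof (rule C1_onI)
  show "has_wirtinger (\<lambda>x. F (zcoord x)) (deriv F (zcoord x)) 0 x" if "x \<in> zcoord -` V" for x
    using that assms holomorphic_derivI[of F V] by (intro has_wirtinger_zcoord_compose) auto
  have "continuous_on V (deriv F)"
    using assms holomorphic_deriv holomorphic_on_imp_continuous_on by blast
  then show "continuous_on (zcoord -` V) (\<lambda>x. deriv F (zcoord x))"
    by (rule continuous_on_compose2) (auto intro: continuous_on_zcoord[OF continuous_on_id])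
qed auto

lemma C2_on_holomorphic:
  assumes "open V" "F holomorphic_on V"
  shows "C2_on (zcoord -` V) (\<lambda>x. F (zcoord x))"
proof (rule C2_onI)
  show "has_wirtinger (\<lambda>x. F (zcoord x)) (deriv F (zcoord x)) 0 x" if "x \<in> zcoord -` V" for x
    using that assms holomorphic_derivI[of F V] by (intro has_wirtinger_zcoord_compose) auto
qed (use assms in \<open>auto intro: C1_on_holomorphic holomorphic_deriv C1_on_const open_vimage_zcoord\<close>)

text \<open>On an open set \<open>continuous_on\<close> means continuity at each point, which no
  longer refers to the neighbourhood; hence the local statements combine.\<close>

lemma C1_on_local:
  assumes "\<And>x. \<exists>U. open U \<and> x \<in> U \<and> C1_on U g"
  shows "C1_on UNIV g"
proof -
  have "isCont (dz g) x \<and> isCont (dzbar g) x \<and> has_wirtinger g (dz g x) (dzbar g x) x" for x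
    using assms[of x] unfolding C1_on_def by (metis continuous_on_eq_continuous_at)
  then show ?thesis
    by (auto simp: C1_on_def intro: continuous_at_imp_continuous_on)
qed

lemma C2_on_local:
  assumes "\<And>x. \<exists>U. open U \<and> x \<in> U \<and> C2_on U g"
  shows "C2_on UNIV g"
proof -
  have "C1_on UNIV (dz g)" "C1_on UNIV (dzbar g)"
    using assms unfolding C2_on_def by (metis C1_on_local)+
  moreover have "has_wirtinger g (dz g x) (dzbar g x) x" for x
    using assms[of x] unfolding C2_on_def by auto
  ultimately show ?thesis
    by (auto simp: C2_on_def)
qed

section \<open>Second order differentiability as bounded linear maps\<close>

lemma twice_cont_diff_complex:
  assumes "C2_on UNIV g"
  shows "twice_cont_diff g"
proof -
  define Z where "Z = Blinfun zcoord"
  define Zc where "Zc = Blinfun (\<lambda>h. cnj (zcoord h))"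
  \<comment> \<open>\<open>P A\<close> is multiplication of \<open>zcoord h\<close> by
    \<open>A\<close>, and \<open>Pc A\<close> is multiplication of its conjugate by
    \<open>A\<close>. Both depend linearly on \<open>A\<close>, so the second derivative of
    \<open>g\<close> arises by applying them to the derivatives of \<open>dz g\<close> and
    \<open>dzbar g\<close>.\<close>
  define P where "P A = blinfun_mult_right A o\<^sub>L Z" for A
  define Pc where "Pc A = blinfun_mult_right A o\<^sub>L Zc" for A
  have Z: "blinfun_apply Z = zcoord"
    unfolding Z_def by (rule bounded_linear_Blinfun_apply[OF bounded_linear_zcoord])
  have Zc: "blinfun_apply Zc = (\<lambda>h. cnj (zcoord h))"
    unfolding Zc_def
    by (rule bounded_linear_Blinfun_apply)
      (rule bounded_linear_compose[OF bounded_linear_cnj bounded_linear_zcoord])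
  have blP: "bounded_linear P" unfolding P_def
    by (rule bounded_linear_compose[OF bounded_bilinear.bounded_linear_left[OF bounded_bilinear_blinfun_compose] bounded_linear_blinfun_mult_right])
  have blPc: "bounded_linear Pc" unfolding Pc_def
    by (rule bounded_linear_compose[OF bounded_bilinear.bounded_linear_left[OF bounded_bilinear_blinfun_compose] bounded_linear_blinfun_mult_right])
  note bl = bounded_linear_Blinfun_apply[OF blP] bounded_linear_Blinfun_apply[OF blPc]
  define g' where "g' x = P (dz g x) + Pc (dzbar g x)" for x
  define g'' where "g'' x =
    (Blinfun P o\<^sub>L (P (dz (dz g) x) + Pc (dzbar (dz g) x))) +
    (Blinfun Pc o\<^sub>L (P (dz (dzbar g) x) + Pc (dzbar (dzbar g) x)))" for x
  have ap: "blinfun_apply (P A + Pc B) = (\<lambda>h. A * zcoord h + B * cnj (zcoord h))" for A B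
    by (auto simp: P_def Pc_def Z Zc blinfun.add_left fun_eq_iff)
  show ?thesis
    unfolding twice_cont_diff_def
  proof (intro exI conjI allI)
    show "(g has_derivative blinfun_apply (g' x)) (at x)" for x
      using assms by (simp add: g'_def ap C2_on_def has_wirtinger_def)
    show "(g' has_derivative blinfun_apply (g'' x)) (at x)" for x
    proof -
      have "(dz g has_derivative blinfun_apply (P (dz (dz g) x) + Pc (dzbar (dz g) x))) (at x)"
        "(dzbar g has_derivative blinfun_apply (P (dz (dzbar g) x) + Pc (dzbar (dzbar g) x))) (at x)"
        using assms by (simp_all add: ap C2_on_def C1_on_def has_wirtinger_def)
      from has_derivative_add[OF bounded_linear.has_derivative[OF blP this(1)]
          bounded_linear.has_derivative[OF blPc this(2)]]
      show ?thesis
        unfolding g'_def g''_def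
        by (rule has_derivative_eq_rhs) (simp add: fun_eq_iff blinfun.add_left bl)
    qed
    show "continuous_on UNIV g''"
      unfolding g''_def using assms
      by (intro continuous_on_add continuous_intros bounded_linear.continuous_on[OF blP]
          bounded_linear.continuous_on[OF blPc]) (auto simp: C2_on_def C1_on_def)
  qed
qed

text \<open>Composition with \<open>L\<close> acts on derivatives as a bounded linear operator
  \<open>M\<close>, so the rule for the first derivative can be applied once more to the
  second.\<close>

lemma twice_cont_diff_bounded_linear:
  fixes g :: "'a::real_normed_vector \<Rightarrow> 'b::real_normed_vector" and L :: "'b \<Rightarrow> 'c::real_normed_vector"
  assumes "bounded_linear L" "twice_cont_diff g"
  shows "twice_cont_diff (\<lambda>x. L (g x))"
proof -
  obtain g' g'' where g:
    "\<And>x. (g has_derivative blinfun_apply (g' x)) (at x)"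
    "\<And>x. (g' has_derivative blinfun_apply (g'' x)) (at x)" "continuous_on UNIV g''"
    using assms(2) unfolding twice_cont_diff_def by blast
  define M :: "('a \<Rightarrow>\<^sub>L 'b) \<Rightarrow> ('a \<Rightarrow>\<^sub>L 'c)" where "M = (o\<^sub>L) (Blinfun L)"
  have M: "bounded_linear M"
    unfolding M_def by (rule bounded_bilinear.bounded_linear_right[OF bounded_bilinear_blinfun_compose])
  note L = bounded_linear_Blinfun_apply[OF assms(1)] and Ma = bounded_linear_Blinfun_apply[OF M]
  show ?thesis
    unfolding twice_cont_diff_def
  proof (intro exI conjI allI)
    show "((\<lambda>x. L (g x)) has_derivative blinfun_apply (M (g' x))) (at x)" for x
      using bounded_linear.has_derivative[OF assms(1) g(1)]
      by (rule has_derivative_eq_rhs) (simp add: M_def L fun_eq_iff)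
    show "((\<lambda>x. M (g' x)) has_derivative blinfun_apply (Blinfun M o\<^sub>L g'' x)) (at x)" for x
      using bounded_linear.has_derivative[OF M g(2)]
      by (rule has_derivative_eq_rhs) (simp add: Ma fun_eq_iff)
    show "continuous_on UNIV (\<lambda>x. Blinfun M o\<^sub>L g'' x)"
      by (intro continuous_intros g)
  qed
qed

lemma twice_cont_diff_add:
  assumes "twice_cont_diff f" "twice_cont_diff g"
  shows "twice_cont_diff (\<lambda>x. f x + g x)"
proof -
  obtain f' f'' where f:
    "\<And>x. (f has_derivative blinfun_apply (f' x)) (at x)"
    "\<And>x. (f' has_derivative blinfun_apply (f'' x)) (at x)" "continuous_on UNIV f''"
    using assms(1) unfolding twice_cont_diff_def by blast
  obtain g' g'' where g:
    "\<And>x. (g has_derivative blinfun_apply (g' x)) (at x)"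
    "\<And>x. (g' has_derivative blinfun_apply (g'' x)) (at x)" "continuous_on UNIV g''"
    using assms(2) unfolding twice_cont_diff_def by blast
  show ?thesis
    unfolding twice_cont_diff_def
  proof (intro exI conjI allI)
    show "((\<lambda>x. f x + g x) has_derivative blinfun_apply (f' x + g' x)) (at x)" for x
      using has_derivative_add[OF f(1) g(1)]
      by (rule has_derivative_eq_rhs) (simp add: fun_eq_iff blinfun.add_left)
    show "((\<lambda>x. f' x + g' x) has_derivative blinfun_apply (f'' x + g'' x)) (at x)" for x
      using has_derivative_add[OF f(2) g(2)]
      by (rule has_derivative_eq_rhs) (simp add: fun_eq_iff blinfun.add_left)
    show "continuous_on UNIV (\<lambda>x. f'' x + g'' x)"
      by (intro continuous_intros f g)
  qed
qed

lemma twice_cont_diff_differentiable: "twice_cont_diff g \<Longrightarrow> g differentiable (at x)"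
  unfolding twice_cont_diff_def differentiable_def by blast

lemma twice_cont_diff_continuous_partial:
  fixes g :: "real^2 \<Rightarrow> 'b::real_normed_vector"
  assumes "twice_cont_diff g"
  shows "continuous_on UNIV (partial i g)"
proof -
  obtain g' g'' where g:
    "\<And>x. (g has_derivative blinfun_apply (g' x)) (at x)"
    "\<And>x. (g' has_derivative blinfun_apply (g'' x)) (at x)"
    using assms unfolding twice_cont_diff_def by blast
  have "partial i g = (\<lambda>x. blinfun_apply (g' x) (axis i 1))"
    using partial_eqI[OF g(1)] by blast
  moreover have "continuous_on UNIV g'"
    using g(2) by (blast intro: continuous_at_imp_continuous_on has_derivative_continuous)
  ultimately show ?thesis by (simp add: continuous_intros)
qed

subsection \<open>Stereographic coordinates and the energy density\<close>

text \<open>The real form of the remainder integrand: its two numerator factors are conjugate to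
  each other, so their product is a squared modulus. The choice of chart is expressed through the
  height of \<open>n x\<close>.\<close>

definition stereo_remainder :: "real \<Rightarrow> real \<Rightarrow> (real^2 \<Rightarrow> real^3) \<Rightarrow> real^2 \<Rightarrow> real" where
  "stereo_remainder \<kappa> \<alpha> n x =
     (let wc = (\<lambda>y. fin_part (stereo_w (n y))); vc = (\<lambda>y. fin_part (stereo_v (n y)))
      in if n x $ 3 \<noteq> -1
         then 8 * (cmod (dzbar wc x - \<i> / 2 * of_real \<kappa> * exp (\<i> * of_real \<alpha>) * (wc x)\<^sup>2))\<^sup>2
                / (1 + (cmod (wc x))\<^sup>2)\<^sup>2
         else 8 * (cmod (dzbar vc x + \<i> / 2 * of_real \<kappa> * exp (\<i> * of_real \<alpha>)))\<^sup>2
                / (1 + (cmod (vc x))\<^sup>2)\<^sup>2)"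

lemma stereo_remainder_nonneg: "0 \<le> stereo_remainder \<kappa> \<alpha> n x"
  by (simp add: stereo_remainder_def Let_def)

lemma stereo_w_eq_Infty_iff: "stereo_w u = Infty \<longleftrightarrow> u $ 3 = -1"
  by (simp add: stereo_w_def)

lemma sphere_inverse_invol [simp]: "sphere_inverse (sphere_inverse a) = a"
  by (cases a) auto

lemma sphere_inverse_stereo_v: "sphere_inverse (stereo_v u) = stereo_w u"
  by (simp add: stereo_v_def)

section \<open>Stereographic charts in terms of planar part and height\<close>

definition planar :: "real^3 \<Rightarrow> complex" where
  "planar u = Complex (u $ 1) (u $ 2)"

lemma bounded_linear_planar: "bounded_linear planar"
proof -
  have "linear planar"
    by (rule linearI) (auto simp: planar_def complex_eq_iff)
  then show ?thesis by (simp add: linear_conv_bounded_linear)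
qed

lemma sphere_planar_norm:
  assumes "(u $ 1)\<^sup>2 + (u $ 2)\<^sup>2 + (u $ 3)\<^sup>2 = 1"
  shows "(cmod (planar u))\<^sup>2 = (1 - u $ 3) * (1 + u $ 3)"
  using assms unfolding planar_def cmod_power2 by (simp add: algebra_simps power2_eq_square)

lemma sphere_planar_mult_cnj:
  assumes "(u $ 1)\<^sup>2 + (u $ 2)\<^sup>2 + (u $ 3)\<^sup>2 = 1"
  shows "planar u * cnj (planar u) = of_real (1 - u $ 3) * of_real (1 + u $ 3)"
  by (metis assms complex_norm_square of_real_mult of_real_power sphere_planar_norm)

lemma sphere_planar_eq_0_iff:
  assumes "(u $ 1)\<^sup>2 + (u $ 2)\<^sup>2 + (u $ 3)\<^sup>2 = 1"
  shows "planar u = 0 \<longleftrightarrow> u $ 3 = 1 \<or> u $ 3 = -1"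
proof -
  have "planar u = 0 \<longleftrightarrow> (1 - u $ 3) * (1 + u $ 3) = 0"
    using sphere_planar_norm[OF assms] by (metis norm_eq_zero zero_eq_power2)
  then show ?thesis by auto
qed

text \<open>This also holds at the south pole and the formula for \<open>stereo_v\<close> below also holds at
  the north pole, because \<open>inverse 0 = 0\<close> matches the dummy value of \<open>fin_part\<close> at \<open>Infty\<close>.\<close>

lemma fin_part_stereo_w:
  "fin_part (stereo_w u) = planar u * inverse (1 + of_real (u $ 3))"
  by (simp add: stereo_w_def planar_def divide_inverse)

lemma stereo_v_eq_Infty_iff:
  assumes "(u $ 1)\<^sup>2 + (u $ 2)\<^sup>2 + (u $ 3)\<^sup>2 = 1"
  shows "stereo_v u = Infty \<longleftrightarrow> u $ 3 = 1"
proof (cases "u $ 3 = -1")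
  case False
  then have "(1::complex) + of_real (u $ 3) \<noteq> 0"
    by (metis add.commute add_eq_0_iff of_real_1 of_real_eq_iff of_real_minus)
  then show ?thesis
    using False sphere_planar_eq_0_iff[OF assms] by (simp add: stereo_v_def stereo_w_def planar_def)
qed (simp add: stereo_v_def stereo_w_def)

lemma fin_part_stereo_v:
  assumes "(u $ 1)\<^sup>2 + (u $ 2)\<^sup>2 + (u $ 3)\<^sup>2 = 1"
  shows "fin_part (stereo_v u) = cnj (planar u) * inverse (1 - of_real (u $ 3))"
proof (cases "u $ 3 = -1 \<or> u $ 3 = 1")
  case True
  then show ?thesis
    using sphere_planar_eq_0_iff[OF assms] by (auto simp: stereo_v_def stereo_w_def planar_def)
next
  case False
  then have *: "(1::complex) + of_real (u $ 3) \<noteq> 0" "(1::complex) - of_real (u $ 3) \<noteq> 0"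
    by (metis add.commute add_eq_0_iff of_real_1 of_real_eq_iff of_real_minus)
      (metis False of_real_1 of_real_eq_iff right_minus_eq)
  have p: "planar u \<noteq> 0" using False sphere_planar_eq_0_iff[OF assms] by simp
  have "stereo_v u = Fin ((1 + of_real (u $ 3)) / planar u)"
    using False p * by (simp add: stereo_v_def stereo_w_def planar_def)
  \<comment> \<open>The fraction is rationalised by \<open>cnj (planar u)\<close>; the factor
    \<open>1 + u $ 3\<close> then cancels.\<close>
  then show ?thesis
    using sphere_planar_mult_cnj[OF assms] * p by (simp add: field_simps)
qed

text \<open>The \<open>p\<close>'s and \<open>q\<close>'s are the components of the two partial
  derivatives of the field, \<open>t\<close> is the inverse of \<open>1 + n3\<close>,
  \<open>k\<close> is the coupling, and \<open>c\<close>, \<open>s\<close> are the cosine and sine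
  of the angle. Both sides are quadratic polynomials in \<open>k\<close>, compared coefficient by
  coefficient.\<close>

lemma finite_chart_identity:
  fixes n1 n2 n3 p1 p2 p3 q1 q2 q3 t k c s :: real
  assumes "t * (1 + n3) = 1" "n1\<^sup>2 + n2\<^sup>2 + n3\<^sup>2 = 1"
    "n1*p1 + n2*p2 + n3*p3 = 0" "n1*q1 + n2*q2 + n3*q3 = 0" "c\<^sup>2 + s\<^sup>2 = 1"
  shows "(p1\<^sup>2 + p2\<^sup>2 + p3\<^sup>2 + (q1\<^sup>2 + q2\<^sup>2 + q3\<^sup>2)) / 2
     + k * (n3*(c*p2 + s*p1) - s*n1*p3 - c*n2*p3 + (c*n1*q3 - s*n2*q3 + n3*(s*q2 - c*q1)))
     + k\<^sup>2 / 2 * (1 - n3)\<^sup>2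
   = (n1*(p2*q3 - p3*q2) + n2*(p3*q1 - p1*q3) + n3*(p1*q2 - p2*q1))
     + k * (s*p1 + c*p2 - c*q1 + s*q2)
     + ((p1 - q2 - t*(p3*n1 - q3*n2) + k*t*(s*(n1\<^sup>2 - n2\<^sup>2) + c*(2*n1*n2)))\<^sup>2
        + (p2 + q1 - t*(p3*n2 + q3*n1) - k*t*(c*(n1\<^sup>2 - n2\<^sup>2) - s*(2*n1*n2)))\<^sup>2) / 2"
proof -
  \<comment> \<open>\<open>?a + i ?b\<close> is \<open>2 / t\<close> times the \<open>dzbar\<close>
    derivative of the coordinate \<open>w\<close>. Below, \<open>?x\<close> and \<open>?y\<close>
    are the real and imaginary parts of the square of \<open>n1 + i n2\<close>.\<close>
  let ?a = "p1 - q2 - t*(p3*n1 - q3*n2)" and ?b = "p2 + q1 - t*(p3*n2 + q3*n1)"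
  let ?x = "n1\<^sup>2 - n2\<^sup>2" and ?y = "2*n1*n2"
  \<comment> \<open>Order zero: the Dirichlet term against the charge density, the completion of
    squares familiar from the pure sigma model.\<close>
  have k0: "p1\<^sup>2 + p2\<^sup>2 + p3\<^sup>2 + (q1\<^sup>2 + q2\<^sup>2 + q3\<^sup>2)
      - 2*(n1*(p2*q3 - p3*q2) + n2*(p3*q1 - p1*q3) + n3*(p1*q2 - p2*q1)) = ?a\<^sup>2 + ?b\<^sup>2"
    using assms(1-4) by algebra
  \<comment> \<open>Order one: the twisted curl term and the vorticity density differ by the cross
    term of the squares.\<close>
  have k1: "n3*(c*p2 + s*p1) - s*n1*p3 - c*n2*p3 + (c*n1*q3 - s*n2*q3 + n3*(s*q2 - c*q1))
      - (s*p1 + c*p2 - c*q1 + s*q2) = t*(?a*(s*?x + c*?y) - ?b*(c*?x - s*?y))"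
    using assms(1-4) by algebra
  \<comment> \<open>Order two: rotation by the angle preserves
    \<open>?x^2 + ?y^2 = (n1^2 + n2^2)^2\<close>, and
    \<open>n1^2 + n2^2 = (1 - n3) * (1 + n3)\<close>.\<close>
  have k2: "(1 - n3)\<^sup>2 = t\<^sup>2 * ((s*?x + c*?y)\<^sup>2 + (c*?x - s*?y)\<^sup>2)"
    using assms(1,2,5) by algebra
  show ?thesis using k0 k1 k2 by algebra
qed

text \<open>The counterpart at the south pole, where the tangent plane is horizontal and hence
  \<open>p3\<close> and \<open>q3\<close> vanish. The squares are those of the residual in the
  coordinate \<open>v\<close>.\<close>

lemma infinite_chart_identity:
  fixes n1 n2 n3 p1 p2 p3 q1 q2 q3 k c s :: real
  assumes "n3 = -1" "n1 = 0" "n2 = 0" "p3 = 0" "q3 = 0" "c\<^sup>2 + s\<^sup>2 = 1"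
  shows "(p1\<^sup>2 + p2\<^sup>2 + p3\<^sup>2 + (q1\<^sup>2 + q2\<^sup>2 + q3\<^sup>2)) / 2
     + k * (n3*(c*p2 + s*p1) - s*n1*p3 - c*n2*p3 + (c*n1*q3 - s*n2*q3 + n3*(s*q2 - c*q1)))
     + k\<^sup>2 / 2 * (1 - n3)\<^sup>2
   = (n1*(p2*q3 - p3*q2) + n2*(p3*q1 - p1*q3) + n3*(p1*q2 - p2*q1))
     + k * (s*p1 + c*p2 - c*q1 + s*q2)
     + ((p1 + q2 - 2*k* s)\<^sup>2 + (q1 - p2 + 2*k*c)\<^sup>2) / 2"
  using assms by algebra

section \<open>Pointwise energy decomposition of a sphere-valued field\<close>

context
  fixes n :: "real^2 \<Rightarrow> real^3"
  assumes n: "sphere_field n"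
begin

lemma sphere_field_unit: "(n x $ 1)\<^sup>2 + (n x $ 2)\<^sup>2 + (n x $ 3)\<^sup>2 = 1"
  using n by (simp add: sphere_field_def)

lemma sphere_field_differentiable: "n differentiable (at x)"
  using n by (simp add: sphere_field_def twice_cont_diff_differentiable)

lemma sphere_field_continuous: "continuous_on UNIV n"
  by (meson sphere_field_differentiable continuous_at_imp_continuous_on differentiable_imp_continuous_within)

text \<open>Differentiate the constant function \<open>n y \<bullet> n y = 1\<close>.\<close>

lemma sphere_field_orthogonal: "n x \<bullet> partial i n x = 0"
proof -
  obtain n' where n': "(n has_derivative n') (at x)"
    using sphere_field_differentiable by (auto simp: differentiable_def)
  have "(\<lambda>y. n y \<bullet> n y) = (\<lambda>y. 1)"
    using sphere_field_unit by (simp add: inner_vec_def sum_3 power2_eq_square)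
  then have "((\<lambda>y. 1) has_derivative (\<lambda>h. n x \<bullet> n' h + n' h \<bullet> n x)) (at x)"
    using has_derivative_inner[OF n' n'] by simp
  then have "(\<lambda>h. n x \<bullet> n' h + n' h \<bullet> n x) = (\<lambda>h. 0)"
    by (rule has_derivative_unique) simp
  then show ?thesis
    unfolding partial_eqI[OF n'] by (metis inner_commute mult_2 mult_eq_0_iff zero_neq_numeral)
qed

lemma has_wirtinger_planar:
  "has_wirtinger (\<lambda>y. planar (n y)) (dz (\<lambda>y. planar (n y)) x)
     ((planar (partial 1 n x) + \<i> * planar (partial 2 n x)) / 2) x"
proof -
  have "(\<lambda>y. planar (n y)) differentiable (at x)"
    by (rule differentiable_bounded_linear[OF bounded_linear_planar sphere_field_differentiable])
  from has_wirtinger_partial[OF this] show ?thesis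
    by (simp add: dzbar_def partial_bounded_linear[OF bounded_linear_planar sphere_field_differentiable])
qed

lemma has_wirtinger_height:
  "has_wirtinger (\<lambda>y. of_real (n y $ 3)) (dz (\<lambda>y. of_real (n y $ 3)) x)
     ((of_real (partial 1 n x $ 3) + \<i> * of_real (partial 2 n x $ 3)) / 2) x"
proof -
  have bl: "bounded_linear (\<lambda>u::real^3. complex_of_real (u $ 3))"
    by (rule bounded_linear_compose[OF bounded_linear_of_real bounded_linear_vec_nth])
  have "(\<lambda>y. complex_of_real (n y $ 3)) differentiable (at x)"
    by (rule differentiable_bounded_linear[OF bl sphere_field_differentiable])
  from has_wirtinger_partial[OF this] show ?thesis
    by (simp add: dzbar_def partial_bounded_linear[OF bl sphere_field_differentiable])
qed

text \<open>Product and quotient rules for \<open>planar (n y) / (1 + n y $ 3)\<close>. The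
  Bogomol'nyi equation concerns only the \<open>dzbar\<close> coefficient, so the other one is left
  existential.\<close>

lemma has_wirtinger_stereo_w:
  assumes "n x $ 3 \<noteq> -1"
  shows "\<exists>A. has_wirtinger (\<lambda>y. fin_part (stereo_w (n y))) A
    ((planar (partial 1 n x) + \<i> * planar (partial 2 n x)) / 2 * inverse (1 + of_real (n x $ 3))
     - planar (n x) * ((of_real (partial 1 n x $ 3) + \<i> * of_real (partial 2 n x $ 3)) / 2
         / (1 + of_real (n x $ 3))\<^sup>2)) x"
proof -
  have "(1::complex) + of_real (n x $ 3) \<noteq> 0"
    by (metis add.commute add_eq_0_iff assms of_real_1 of_real_eq_iff of_real_minus)
  then show ?thesis
    unfolding fin_part_stereo_w
    using has_wirtinger_mult[OF has_wirtinger_planar has_wirtinger_inverse[OF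
       has_wirtinger_add[OF has_wirtinger_const has_wirtinger_height]]] by fastforce
qed

text \<open>The numerator is now \<open>cnj (planar (n y))\<close>. Conjugation exchanges the two
  coefficients, which is why \<open>dz\<close> of the planar part enters the \<open>dzbar\<close>
  coefficient.\<close>

lemma has_wirtinger_stereo_v:
  assumes "n x $ 3 \<noteq> 1"
  shows "\<exists>B. has_wirtinger (\<lambda>y. fin_part (stereo_v (n y))) B (cnj (dz (\<lambda>y. planar (n y)) x)
     * inverse (1 - of_real (n x $ 3))
     + cnj (planar (n x)) * ((of_real (partial 1 n x $ 3) + \<i> * of_real (partial 2 n x $ 3)) / 2
         / (1 - of_real (n x $ 3))\<^sup>2)) x"
proof -
  have "(1::complex) + - of_real (n x $ 3) \<noteq> 0"
    by (metis add.right_inverse assms eq_iff_diff_eq_0 of_real_1 of_real_eq_iff uminus_add_conv_diff add.commute)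
  then show ?thesis
    unfolding fin_part_stereo_v[OF sphere_field_unit]
    using has_wirtinger_mult[OF has_wirtinger_cnj[OF has_wirtinger_planar] has_wirtinger_inverse[OF
       has_wirtinger_add[OF has_wirtinger_const has_wirtinger_minus[OF has_wirtinger_height]]]] by fastforce
qed

text \<open>Since \<open>dz\<close> of \<open>cnj w\<close> is the conjugate of
  \<open>dzbar w\<close>, and \<open>exp (- \<i> * \<alpha>)\<close> is the conjugate of
  \<open>exp (\<i> * \<alpha>)\<close>, the second factor is the conjugate of the first.\<close>

lemma remainder_density_eq:
  "remainder_density \<kappa> \<alpha> (\<lambda>y. stereo_w (n y)) x = of_real (stereo_remainder \<kappa> \<alpha> n x)"
proof (cases "n x $ 3 = -1")
  case True
  then show ?thesis
    by (simp add: remainder_density_def stereo_remainder_def stereo_w_eq_Infty_iff stereo_v_def)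
next
  case False
  define wc where "wc = (\<lambda>y. fin_part (stereo_w (n y)))"
  obtain A B where w: "has_wirtinger wc A B x"
    using has_wirtinger_stereo_w[OF False] by (auto simp: wc_def)
  have "dz (\<lambda>y. cnj (wc y)) x + \<i> / 2 * of_real \<kappa> * exp (- \<i> * of_real \<alpha>) * (cnj (wc x))\<^sup>2
      = cnj (dzbar wc x - \<i> / 2 * of_real \<kappa> * exp (\<i> * of_real \<alpha>) * (wc x)\<^sup>2)"
    using has_wirtinger_dz[OF w] has_wirtinger_dz[OF has_wirtinger_cnj[OF w]]
    by (simp add: exp_cnj)
  then show ?thesis
    using False
    by (simp add: remainder_density_def stereo_remainder_def stereo_w_eq_Infty_iff Let_def
        flip: wc_def complex_norm_square del: complex_cnj_diff)
qed

definition energy_density :: "real \<Rightarrow> real \<Rightarrow> real^2 \<Rightarrow> real" where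
  "energy_density \<kappa> \<alpha> x = ((norm (partial 1 n x))\<^sup>2 + (norm (partial 2 n x))\<^sup>2) / 2
     + \<kappa> * dmi_density \<alpha> n x + \<kappa>\<^sup>2 / 2 * (1 - n x $ 3)\<^sup>2"

definition vorticity_density :: "real \<Rightarrow> real \<Rightarrow> real^2 \<Rightarrow> real" where
  "vorticity_density \<kappa> \<alpha> x =
     \<kappa> * (partial 1 (\<lambda>y. rot3 \<alpha> (n y) $ 2) x - partial 2 (\<lambda>y. rot3 \<alpha> (n y) $ 1) x)"

definition charge_density :: "real^2 \<Rightarrow> real" where
  "charge_density x = n x \<bullet> cross3 (partial 1 n x) (partial 2 n x)"

lemma dmi_density_eq:
  "dmi_density \<alpha> n x = (let p = partial 1 n x; q = partial 2 n x in
     n x $ 3 * (cos \<alpha> * p $ 2 + sin \<alpha> * p $ 1) - sin \<alpha> * n x $ 1 * p $ 3 - cos \<alpha> * n x $ 2 * p $ 3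
     + (cos \<alpha> * n x $ 1 * q $ 3 - sin \<alpha> * n x $ 2 * q $ 3 + n x $ 3 * (sin \<alpha> * q $ 2 - cos \<alpha> * q $ 1)))"
  by (simp add: dmi_density_def Let_def rot3_def cross3_def inner_vec_def sum_3 vector_3 axis_def algebra_simps)

lemma vorticity_density_eq:
  "vorticity_density \<kappa> \<alpha> x = (let p = partial 1 n x; q = partial 2 n x in
     \<kappa> * (sin \<alpha> * p $ 1 + cos \<alpha> * p $ 2 - cos \<alpha> * q $ 1 + sin \<alpha> * q $ 2))"
proof -
  have "bounded_linear (\<lambda>u. rot3 \<alpha> u $ 2)" "bounded_linear (\<lambda>u. rot3 \<alpha> u $ 1)"
    by (auto intro!: linear_conv_bounded_linear[THEN iffD1] linearI simp: rot3_def vector_3 algebra_simps)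
  note bl = this
  have "partial 1 (\<lambda>y. rot3 \<alpha> (n y) $ 2) x = rot3 \<alpha> (partial 1 n x) $ 2"
    by (rule partial_bounded_linear[OF bl(1) sphere_field_differentiable])
  moreover have "partial 2 (\<lambda>y. rot3 \<alpha> (n y) $ 1) x = rot3 \<alpha> (partial 2 n x) $ 1"
    by (rule partial_bounded_linear[OF bl(2) sphere_field_differentiable])
  moreover have "rot3 \<alpha> u $ 2 = sin \<alpha> * u $ 1 + cos \<alpha> * u $ 2"
    "rot3 \<alpha> u $ 1 = cos \<alpha> * u $ 1 - sin \<alpha> * u $ 2" for u
    by (simp_all add: rot3_def vector_3)
  ultimately show ?thesis
    by (simp only: vorticity_density_def Let_def) (simp only: algebra_simps)
qed

lemma charge_density_eq:
  "charge_density x = (let p = partial 1 n x; q = partial 2 n x in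
     n x $ 1 * (p $ 2 * q $ 3 - p $ 3 * q $ 2) + n x $ 2 * (p $ 3 * q $ 1 - p $ 1 * q $ 3)
     + n x $ 3 * (p $ 1 * q $ 2 - p $ 2 * q $ 1))"
  by (simp add: charge_density_def Let_def cross3_def inner_vec_def sum_3 vector_3)

text \<open>Each point is treated in the chart that \<open>stereo_remainder\<close> uses there. The
  residual is computed as a multiple of a number \<open>X\<close> whose real and imaginary parts are
  the two squared terms of the matching chart identity.\<close>

lemma energy_density_decompose:
  "energy_density \<kappa> \<alpha> x = charge_density x + vorticity_density \<kappa> \<alpha> x + stereo_remainder \<kappa> \<alpha> n x"
proof -
  define p where "p = partial 1 n x"
  define q where "q = partial 2 n x"
  define c s where "c = cos \<alpha>" and "s = sin \<alpha>"
  define u where "u = n x"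
  have norm3: "(norm a)\<^sup>2 = (a $ 1)\<^sup>2 + (a $ 2)\<^sup>2 + (a $ 3)\<^sup>2" for a :: "real^3"
    unfolding power2_norm_eq_inner by (simp add: inner_vec_def sum_3 power2_eq_square)
  have unit: "(u $ 1)\<^sup>2 + (u $ 2)\<^sup>2 + (u $ 3)\<^sup>2 = 1"
    by (simp add: u_def sphere_field_unit)
  have orth: "u $ 1 * p $ 1 + u $ 2 * p $ 2 + u $ 3 * p $ 3 = 0"
    "u $ 1 * q $ 1 + u $ 2 * q $ 2 + u $ 3 * q $ 3 = 0"
    using sphere_field_orthogonal[of x 1] sphere_field_orthogonal[of x 2]
    by (simp_all add: u_def p_def q_def inner_vec_def sum_3)
  have cs: "c\<^sup>2 + s\<^sup>2 = 1" by (simp add: c_def s_def)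
  have eia: "exp (\<i> * of_real \<alpha>) = Complex c s"
    by (simp add: c_def s_def complex_eq_iff Re_exp Im_exp)
  note defs = energy_density_def dmi_density_eq vorticity_density_eq charge_density_eq Let_def norm3
    p_def[symmetric] q_def[symmetric] c_def[symmetric] s_def[symmetric] u_def[symmetric]
  show ?thesis
  proof (cases "u $ 3 = -1")
    case False
    define t where "t = inverse (1 + u $ 3)"
    have t: "t * (1 + u $ 3) = 1" using False by (auto simp: t_def add_eq_0_iff)
    then have t0: "t \<noteq> 0" by auto
    have tc: "inverse (1 + complex_of_real (u $ 3)) = of_real t"
      by (simp add: t_def)
    define wc where "wc = (\<lambda>y. fin_part (stereo_w (n y)))"
    have wx: "wc x = of_real t * planar u"
      unfolding wc_def fin_part_stereo_w by (simp add: tc flip: u_def)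
    have dw: "dzbar wc x = of_real t * ((planar p + \<i> * planar q) / 2
        - of_real t * planar u * (of_real (p $ 3) + \<i> * of_real (q $ 3)) / 2)"
    proof -
      obtain A where "has_wirtinger wc A ((planar p + \<i> * planar q) / 2 * inverse (1 + of_real (u $ 3))
          - planar u * ((of_real (p $ 3) + \<i> * of_real (q $ 3)) / 2 / (1 + of_real (u $ 3))\<^sup>2)) x"
        using has_wirtinger_stereo_w[of x] False unfolding wc_def p_def q_def u_def by blast
      from has_wirtinger_dz(2)[OF this] have "dzbar wc x = (planar p + \<i> * planar q) / 2 * of_real t
          - planar u * ((of_real (p $ 3) + \<i> * of_real (q $ 3)) / 2 * (of_real t)\<^sup>2)"
        by (simp only: tc divide_inverse[of _ "(1 + _)\<^sup>2"] flip: power_inverse)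
      also have "\<dots> = of_real t * ((planar p + \<i> * planar q) / 2
        - of_real t * planar u * (of_real (p $ 3) + \<i> * of_real (q $ 3)) / 2)"
        by (simp add: algebra_simps power2_eq_square)
      finally show ?thesis .
    qed
    have den: "1 + (cmod (wc x))\<^sup>2 = 2 * t"
    proof -
      have "(cmod (wc x))\<^sup>2 = t\<^sup>2 * ((1 - u $ 3) * (1 + u $ 3))"
        by (simp add: wx norm_mult power_mult_distrib sphere_planar_norm[OF unit])
      then show ?thesis using t by algebra
    qed
    define X where "X = Complex
       (p$1 - q$2 - t*(p$3*u$1 - q$3*u$2) + \<kappa>*t*(s*((u$1)\<^sup>2 - (u$2)\<^sup>2) + c*(2*u$1*u$2)))
       (p$2 + q$1 - t*(p$3*u$2 + q$3*u$1) - \<kappa>*t*(c*((u$1)\<^sup>2 - (u$2)\<^sup>2) - s*(2*u$1*u$2)))"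
    have num: "dzbar wc x - \<i> / 2 * of_real \<kappa> * exp (\<i> * of_real \<alpha>) * (wc x)\<^sup>2 = of_real (t / 2) * X"
      unfolding dw wx eia X_def planar_def
      by (simp add: complex_eq_iff power2_eq_square field_simps)
    \<comment> \<open>The powers of \<open>t\<close> cancel:
      \<open>8 * (t / 2)^2 / (2 * t)^2 = 1 / 2\<close>.\<close>
    have "stereo_remainder \<kappa> \<alpha> n x = (cmod X)\<^sup>2 / 2"
      unfolding stereo_remainder_def Let_def wc_def[symmetric] num den
      using False t0 by (simp add: norm_mult power_mult_distrib field_simps flip: u_def)
    then show ?thesis
      using finite_chart_identity[OF t unit orth cs, of \<kappa>]
      by (simp add: defs X_def cmod_power2)
  next
    case True
    then have u12: "u $ 1 = 0" "u $ 2 = 0"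
      using unit by (auto simp: sum_power2_eq_zero_iff)
    then have pq3: "p $ 3 = 0" "q $ 3 = 0" using orth True by auto
    define vc where "vc = (\<lambda>y. fin_part (stereo_v (n y)))"
    have vx: "vc x = 0"
      unfolding vc_def fin_part_stereo_v[OF sphere_field_unit]
      using u12 by (simp add: planar_def Complex_eq flip: u_def)
    have dG: "dz (\<lambda>y. planar (n y)) x = (planar p - \<i> * planar q) / 2"
      unfolding dz_def partial_bounded_linear[OF bounded_linear_planar sphere_field_differentiable]
        p_def q_def ..
    \<comment> \<open>At the south pole \<open>1 - u $ 3 = 2\<close> and
      \<open>planar u = 0\<close>, so only the first summand survives; the two halves give the
      factor \<open>1 / 4\<close>.\<close>
    have dv: "dzbar vc x = cnj (planar p - \<i> * planar q) / 4"
    proof -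
      obtain A where "has_wirtinger vc A (cnj ((planar p - \<i> * planar q) / 2)
         * inverse (1 - of_real (u $ 3))
         + cnj (planar u) * ((of_real (p $ 3) + \<i> * of_real (q $ 3)) / 2
         / (1 - of_real (u $ 3))\<^sup>2)) x"
        using has_wirtinger_stereo_v[of x] True unfolding vc_def p_def q_def u_def
        by (auto simp: dG p_def q_def)
      from has_wirtinger_dz(2)[OF this] show ?thesis
        using True pq3 by simp
    qed
    define X where "X = Complex (p$1 + q$2 - 2*\<kappa>* s) (q$1 - p$2 + 2*\<kappa>*c)"
    have num: "dzbar vc x + \<i> / 2 * of_real \<kappa> * exp (\<i> * of_real \<alpha>) = X / 4"
      unfolding dv eia X_def planar_def by (simp add: complex_eq_iff field_simps)
    have "stereo_remainder \<kappa> \<alpha> n x = (cmod X)\<^sup>2 / 2"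
      unfolding stereo_remainder_def Let_def vc_def[symmetric] num vx
      using True by (simp add: norm_divide power_divide flip: u_def)
    then show ?thesis
      using infinite_chart_identity[OF True u12 pq3 cs, of "p$1" "p$2" "q$1" "q$2" \<kappa>]
      by (simp add: defs X_def cmod_power2)
  qed
qed

lemma continuous_densities:
  "continuous_on S (energy_density \<kappa> \<alpha>)" "continuous_on S (charge_density)"
  "continuous_on S (vorticity_density \<kappa> \<alpha>)" "continuous_on S (stereo_remainder \<kappa> \<alpha> n)"
proof -
  have "continuous_on S (partial i n)" for i
    using n twice_cont_diff_continuous_partial[of n i] continuous_on_subset[of UNIV "partial i n" S]
    by (auto simp: sphere_field_def)
  note cont = this continuous_on_subset[OF sphere_field_continuous subset_UNIV]
  show e: "continuous_on S (energy_density \<kappa> \<alpha>)"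
    unfolding energy_density_def dmi_density_eq Let_def by (intro continuous_intros cont) auto
  show c: "continuous_on S charge_density"
    unfolding charge_density_eq Let_def by (intro continuous_intros cont)
  show v: "continuous_on S (vorticity_density \<kappa> \<alpha>)"
    unfolding vorticity_density_eq Let_def by (intro continuous_intros cont)
  \<comment> \<open>The remainder is defined by cases, but as a difference of continuous densities
    it is continuous without any comparison of the two charts.\<close>
  have "stereo_remainder \<kappa> \<alpha> n = (\<lambda>x. energy_density \<kappa> \<alpha> x - charge_density x - vorticity_density \<kappa> \<alpha> x)"
    by (simp add: energy_density_decompose fun_eq_iff)
  then show "continuous_on S (stereo_remainder \<kappa> \<alpha> n)"
    using e c v by (simp add: continuous_intros)
qed

end

subsection \<open>The Bogomol'nyi equation and holomorphic maps\<close>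

lemma set_integrable_lborel_continuous:
  fixes f :: "'a::euclidean_space \<Rightarrow> real"
  assumes "compact D" "continuous_on UNIV f"
  shows "set_integrable lborel D f"
  unfolding set_integrable_def
  using assms by (intro borel_integrable_compact) (auto intro: continuous_on_subset)

text \<open>If \<open>f\<close> were positive at \<open>x\<close>, it would stay above
  \<open>f x / 2\<close> on a small closed ball, which is compact and of positive measure.\<close>

lemma continuous_nonneg_integral_zero:
  fixes f :: "'a::euclidean_space \<Rightarrow> real"
  assumes cont: "continuous_on UNIV f" and nonneg: "\<And>x. 0 \<le> f x"
    and zero: "\<And>D. compact D \<Longrightarrow> (LINT x:D|lborel. f x) = 0"
  shows "f x = 0"
proof (rule ccontr)
  assume "f x \<noteq> 0"
  then have pos: "0 < f x" using nonneg[of x] by simp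
  have "isCont f x" using cont by (simp add: continuous_on_eq_continuous_at)
  then obtain d where d: "d > 0" "\<And>y. dist y x < d \<Longrightarrow> dist (f y) (f x) < f x / 2"
    using pos unfolding continuous_at_eps_delta by (metis half_gt_zero)
  define D where "D = cball x (d / 2)"
  have low: "f x / 2 \<le> f y" if "y \<in> D" for y
  proof -
    have "dist (f y) (f x) < f x / 2"
      using that d by (intro d(2)) (auto simp: D_def dist_commute)
    then show ?thesis by (auto simp: dist_real_def abs_if split: if_splits)
  qed
  have cD: "compact D" by (simp add: D_def)
  have "0 < measure lborel D * (f x / 2)"
    using pos d content_cball_pos[of "d / 2" x] by (auto simp: D_def)
  also have "\<dots> = (LINT y:D|lborel. f x / 2)"
    unfolding set_lebesgue_integral_def using cD
    by (simp add: D_def emeasure_lborel_cball_finite)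
  also have "\<dots> \<le> (LINT y:D|lborel. f y)"
    using cD cont low by (intro set_integral_mono set_integrable_lborel_continuous) auto
  finally show False using zero[OF cD] by simp
qed

section \<open>Arithmetic on the Riemann sphere\<close>

lemma fin_part_sphere_inverse: "fin_part (sphere_inverse a) = inverse (fin_part a)"
  \<comment> \<open>At \<open>Infty\<close> and at \<open>Fin 0\<close> both sides are
    \<open>0\<close>, by the dummy value of \<open>fin_part\<close> and by
    \<open>inverse 0 = 0\<close>.\<close>
  by (cases a) (auto simp: divide_inverse)

lemma sphere_inverse_eq_iff [simp]:
  "sphere_inverse a = Infty \<longleftrightarrow> a = Fin 0" "sphere_inverse a = Fin 0 \<longleftrightarrow> a = Infty"
  by (cases a; simp)+

lemma fin_part_sphere_translate:
  "a \<noteq> Infty \<Longrightarrow> fin_part (sphere_translate c a) = c + fin_part a"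
  by (cases a) auto

lemma sphere_translate_eq_Infty_iff [simp]: "sphere_translate c a = Infty \<longleftrightarrow> a = Infty"
  by (cases a) auto

lemma sphere_translate_translate:
  "sphere_translate c (sphere_translate d a) = sphere_translate (c + d) a"
  by (cases a) auto

lemma sphere_translate_0 [simp]: "sphere_translate 0 a = a"
  by (cases a) auto

text \<open>At \<open>1 + c * g = 0\<close> the translated point is \<open>Fin 0\<close>, and both sides are \<open>0\<close>
  since \<open>inverse 0 = 0\<close>.\<close>

lemma fin_part_inverse_translate:
  assumes "a \<noteq> Fin 0" "g = fin_part (sphere_inverse a)"
  shows "fin_part (sphere_inverse (sphere_translate c a)) = g * inverse (1 + c * g)"
proof (cases a)
  case (Fin b)
  then have b: "b \<noteq> 0" "g = inverse b" using assms by (auto simp: divide_inverse)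
  have "1 + c * g = (c + b) * inverse b" using b by (simp add: field_simps)
  then show ?thesis using b by (auto simp: Fin divide_inverse)
qed (use assms in simp)

section \<open>From the Cauchy-Riemann equation to holomorphy\<close>

definition xcoord :: "complex \<Rightarrow> real^2" where
  "xcoord z = vector [Re z, Im z]"

lemma zcoord_xcoord [simp]: "zcoord (xcoord z) = z"
  by (simp add: zcoord_def xcoord_def)

lemma xcoord_zcoord [simp]: "xcoord (zcoord x) = x"
  by (simp add: zcoord_def xcoord_def vec_eq_iff forall_2)

lemma bounded_linear_xcoord: "bounded_linear xcoord"
proof -
  have "linear xcoord"
    by (rule linearI) (auto simp: xcoord_def vec_eq_iff forall_2)
  then show ?thesis by (simp add: linear_conv_bounded_linear)
qed

lemma open_vimage_xcoord: "open V \<Longrightarrow> open (xcoord -` V)"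
  by (rule open_vimage) (auto intro: bounded_linear.continuous_on[OF bounded_linear_xcoord])

text \<open>A vanishing \<open>dzbar\<close> coefficient makes the real derivative complex-linear,
  that is, multiplication by \<open>A\<close>.\<close>

lemma has_wirtinger_imp_field_derivative:
  assumes "has_wirtinger (\<lambda>x. F (zcoord x)) A 0 (xcoord z)"
  shows "(F has_field_derivative A) (at z)"
proof -
  have "(xcoord has_derivative xcoord) (at z)"
    by (rule bounded_linear.has_derivative[OF bounded_linear_xcoord has_derivative_ident])
  from has_derivative_compose[OF this assms[unfolded has_wirtinger_def]]
  show ?thesis by (simp add: has_field_derivative_def)
qed

lemma holomorphic_on_wirtinger:
  assumes "open V" "\<And>x. x \<in> V \<Longrightarrow> \<exists>A. has_wirtinger g A 0 x" "\<And>x. x \<in> V \<Longrightarrow> F (zcoord x) = g x"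
  shows "F holomorphic_on (xcoord -` V)"
proof -
  have "\<exists>A. (F has_field_derivative A) (at z)" if z: "z \<in> xcoord -` V" for z
  proof -
    obtain A where "has_wirtinger g A 0 (xcoord z)" using assms(2) z by auto
    then have "has_wirtinger (\<lambda>x. F (zcoord x)) A 0 (xcoord z)"
      by (rule has_wirtinger_cong[where S = V]) (use z assms(1,3) in auto)
    then show ?thesis using has_wirtinger_imp_field_derivative by blast
  qed
  then show ?thesis
    unfolding holomorphic_on_def field_differentiable_def
    by (blast intro: has_field_derivative_at_within)
qed

section \<open>Energy identity and Bogomol'nyi equation for a given field\<close>

context
  fixes n :: "real^2 \<Rightarrow> real^3"
  assumes n: "sphere_field n"
begin

lemma energy_decompose:
  assumes "compact D"
  shows "energy \<kappa> \<alpha> D n = 4 * pi * (charge D n + vorticity \<kappa> \<alpha> D n)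
    + (LINT x:D|lborel. stereo_remainder \<kappa> \<alpha> n x)"
proof -
  note int = continuous_densities[OF n, THEN set_integrable_lborel_continuous[OF assms]]
  have "energy \<kappa> \<alpha> D n = (LINT x:D|lborel. energy_density n \<kappa> \<alpha> x)"
    by (simp add: energy_def energy_density_def[OF n])
  also have "\<dots> = (LINT x:D|lborel. charge_density n x) + (LINT x:D|lborel. vorticity_density n \<kappa> \<alpha> x)
      + (LINT x:D|lborel. stereo_remainder \<kappa> \<alpha> n x)"
    unfolding energy_density_decompose[OF n] using int by (simp add: set_integral_add)
  finally show ?thesis
    by (simp add: charge_def vorticity_def charge_density_def[OF n] vorticity_density_def[OF n] distrib_left)
qed

lemma stereo_remainder_eq_0_iff:
  "stereo_remainder \<kappa> \<alpha> n x = 0 \<longleftrightarrow>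
    (if n x $ 3 \<noteq> -1
     then dzbar (\<lambda>y. fin_part (stereo_w (n y))) x
       = \<i> / 2 * of_real \<kappa> * exp (\<i> * of_real \<alpha>) * (fin_part (stereo_w (n x)))\<^sup>2
     else dzbar (\<lambda>y. fin_part (stereo_v (n y))) x = - (\<i> / 2) * of_real \<kappa> * exp (\<i> * of_real \<alpha>))"
proof -
  have "1 + (cmod z)\<^sup>2 \<noteq> 0" for z by (metis add_pos_nonneg less_irrefl zero_le_power2 zero_less_one)
  then show ?thesis
    by (auto simp: stereo_remainder_def Let_def add_eq_0_iff)
qed

text \<open>The equation switches to \<open>w\<close> only at the north pole, the remainder to
  \<open>v\<close> only at the south pole. At both poles the two conditions use the same chart.
  Elsewhere \<open>v = 1 / w\<close> gives \<open>dzbar v = - dzbar w / w^2\<close>, so the two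
  forms are equivalent.\<close>

lemma bogomolnyi_iff_remainder:
  "bogomolnyi \<kappa> \<alpha> (\<lambda>y. stereo_v (n y)) \<longleftrightarrow> (\<forall>x. stereo_remainder \<kappa> \<alpha> n x = 0)"
proof -
  define c where "c = \<i> / 2 * of_real \<kappa> * exp (\<i> * of_real \<alpha>)"
  let ?w = "\<lambda>y. fin_part (stereo_w (n y))" and ?v = "\<lambda>y. fin_part (stereo_v (n y))"
  have "(if stereo_v (n x) \<noteq> Infty then dzbar ?v x = - c else dzbar ?w x = c * (?w x)\<^sup>2) \<longleftrightarrow>
    (if n x $ 3 \<noteq> -1 then dzbar ?w x = c * (?w x)\<^sup>2 else dzbar ?v x = - c)" for x
  proof (cases "n x $ 3 = 1 \<or> n x $ 3 = -1")
    case True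
    then show ?thesis
      using stereo_v_eq_Infty_iff[OF sphere_field_unit[OF n]] by auto
  next
    case False
    then have fin: "stereo_v (n x) \<noteq> Infty"
      using stereo_v_eq_Infty_iff[OF sphere_field_unit[OF n]] by auto
    have w0: "?w x \<noteq> 0"
      using False fin by (auto simp: stereo_v_def stereo_w_def)
    obtain A where "has_wirtinger ?w A (dzbar ?w x) x"
      using has_wirtinger_stereo_w[OF n, of x] False has_wirtinger_dz by metis
    from has_wirtinger_dz(2)[OF has_wirtinger_inverse[OF this w0]]
    have "dzbar ?v x = - (dzbar ?w x / (?w x)\<^sup>2)"
      by (simp add: stereo_v_def fin_part_sphere_inverse)
    then have "dzbar ?v x = - c \<longleftrightarrow> dzbar ?w x = c * (?w x)\<^sup>2"
      using w0 by (simp only: neg_equal_iff_equal) (simp add: field_simps)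
    then show ?thesis using False fin by simp
  qed
  moreover have "- (\<i> / 2) * of_real \<kappa> * exp (\<i> * of_real \<alpha>) = - c" by (simp add: c_def)
  ultimately show ?thesis
    unfolding bogomolnyi_def Let_def stereo_remainder_eq_0_iff sphere_inverse_stereo_v c_def[symmetric]
    by (simp only:)
qed

lemma open_height_neq: "open {y. n y $ 3 \<noteq> a}"
  by (intro open_Collect_neq continuous_intros sphere_field_continuous[OF n])

lemma bogomolnyi_imp_translate:
  assumes "bogomolnyi \<kappa> \<alpha> (\<lambda>y. stereo_v (n y))"
  defines "c \<equiv> - (\<i> / 2) * of_real \<kappa> * exp (\<i> * of_real \<alpha>)"
  shows "sphere_holomorphic (\<lambda>z. sphere_translate (- c * cnj z) (stereo_v (n (xcoord z))))"
    (is "sphere_holomorphic ?f")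
  unfolding sphere_holomorphic_def
proof
  fix z
  let ?w = "\<lambda>y. fin_part (stereo_w (n y))" and ?v = "\<lambda>y. fin_part (stereo_v (n y))"
  note unit = sphere_field_unit[OF n]
  show "\<exists>U. open U \<and> z \<in> U \<and>
        ((\<forall>u\<in>U. ?f u \<noteq> Infty) \<and> (\<lambda>u. fin_part (?f u)) holomorphic_on U \<or>
         (\<forall>u\<in>U. ?f u \<noteq> Fin 0) \<and> (\<lambda>u. fin_part (sphere_inverse (?f u))) holomorphic_on U)"
  proof (cases "n (xcoord z) $ 3 = 1")
    case False
    define V where "V = {y. n y $ 3 \<noteq> 1}"
    have oV: "open V" unfolding V_def by (rule open_height_neq)
    have fin: "stereo_v (n y) \<noteq> Infty" if "y \<in> V" for y
      using that stereo_v_eq_Infty_iff[OF unit] by (simp add: V_def)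
    have "(\<lambda>u. fin_part (?f u)) holomorphic_on (xcoord -` V)"
    proof (rule holomorphic_on_wirtinger[OF oV])
      fix x assume x: "x \<in> V"
      then have n3: "n x $ 3 \<noteq> 1" by (simp add: V_def)
      obtain A where "has_wirtinger ?v A (dzbar ?v x) x"
        using has_wirtinger_stereo_v[OF n n3] has_wirtinger_dz by metis
      moreover have "dzbar ?v x = c"
        using assms fin[OF x] by (simp add: bogomolnyi_def Let_def)
      ultimately show "\<exists>A. has_wirtinger (\<lambda>x. - c * cnj (zcoord x) + ?v x) A 0 x"
        using has_wirtinger_add[OF has_wirtinger_mult[OF has_wirtinger_const[of "- c" x]
            has_wirtinger_cnj_zcoord], of ?v A c] by auto
    qed (use fin in \<open>simp add: fin_part_sphere_translate\<close>)
    moreover have "z \<in> xcoord -` V" "\<forall>u\<in>xcoord -` V. ?f u \<noteq> Infty"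
      using False fin by (auto simp: V_def)
    ultimately show ?thesis using open_vimage_xcoord[OF oV] by blast
  next
    case True
    let ?d = "\<lambda>y. 1 + (- c * cnj (zcoord y)) * ?w y"
    \<comment> \<open>The second condition keeps the denominator of
      \<open>1 / f = w / (1 - c * cnj z * w)\<close> away from zero. It holds at the given point
      because \<open>w = 0\<close> there.\<close>
    define V where "V = {y. n y $ 3 \<noteq> -1} \<inter> ?d -` (- {0})"
    have cw: "continuous_on {y. n y $ 3 \<noteq> -1} ?w"
      using has_wirtinger_stereo_w[OF n] has_wirtinger_isCont
      by (blast intro: continuous_at_imp_continuous_on)
    have oV: "open V" unfolding V_def
      by (intro continuous_open_preimage continuous_intros cw open_height_neq)
    have nz: "stereo_v (n y) \<noteq> Fin 0" "?f (zcoord y) \<noteq> Fin 0" if "y \<in> V" for y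
    proof -
      show v: "stereo_v (n y) \<noteq> Fin 0"
        using that by (simp add: V_def stereo_v_def stereo_w_eq_Infty_iff)
      have d0: "1 + (- c * cnj (zcoord y)) * fin_part (sphere_inverse (stereo_v (n y))) \<noteq> 0"
        using that unfolding V_def sphere_inverse_stereo_v by blast
      show "?f (zcoord y) \<noteq> Fin 0"
      proof (cases "stereo_v (n y)")
        case (Fin a)
        then have "a \<noteq> 0" using v by auto
        then show ?thesis using Fin d0 by (auto simp: field_simps)
      qed simp
    qed
    have "(\<lambda>u. fin_part (sphere_inverse (?f u))) holomorphic_on (xcoord -` V)"
    proof (rule holomorphic_on_wirtinger[OF oV])
      fix x assume x: "x \<in> V"
      then have d0: "?d x \<noteq> 0" and n3: "n x $ 3 \<noteq> -1" by (auto simp: V_def)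
      obtain A where w: "has_wirtinger ?w A (dzbar ?w x) x"
        using has_wirtinger_stereo_w[OF n n3] has_wirtinger_dz by metis
      \<comment> \<open>By definition the equation is given in terms of \<open>w\<close> only where
        \<open>v\<close> is infinite; the vanishing remainder provides it at every point of
        \<open>V\<close>.\<close>
      have B: "dzbar ?w x = - c * (?w x)\<^sup>2"
        using assms(1) n3 unfolding bogomolnyi_iff_remainder stereo_remainder_eq_0_iff
        by (simp add: c_def)
      have *: "has_wirtinger (\<lambda>x. - c * cnj (zcoord x)) 0 (- c) x"
        using has_wirtinger_mult[OF has_wirtinger_const[of "- c" x] has_wirtinger_cnj_zcoord] by simp
      \<comment> \<open>The terms containing \<open>cnj (zcoord x)\<close> cancel, and what is left
        is \<open>(dzbar ?w x + c * (?w x)^2) / (?d x)^2\<close>, which is zero by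
        \<open>B\<close>.\<close>
      have "dzbar ?w x * inverse (?d x) + ?w x *
         - ((0 + (- c * ?w x + - c * cnj (zcoord x) * dzbar ?w x)) / (?d x)\<^sup>2) = 0"
        using d0 unfolding B by (simp add: divide_simps) (simp add: algebra_simps power2_eq_square)
      with has_wirtinger_mult[OF w has_wirtinger_inverse[OF has_wirtinger_add[OF
          has_wirtinger_const[of 1] has_wirtinger_mult[OF * w]] d0]]
      show "\<exists>A. has_wirtinger (\<lambda>x. ?w x * inverse (?d x)) A 0 x" by metis
    next
      fix x assume "x \<in> V"
      then show "fin_part (sphere_inverse (?f (zcoord x))) = ?w x * inverse (?d x)"
        using fin_part_inverse_translate[OF nz(1) refl, of x "- c * cnj (zcoord x)"]
        by (simp add: sphere_inverse_stereo_v)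
    qed
    moreover have "z \<in> xcoord -` V"
      using True sphere_planar_eq_0_iff[OF unit, of "xcoord z"]
      by (simp add: V_def fin_part_stereo_w)
    moreover have "\<forall>u\<in>xcoord -` V. ?f u \<noteq> Fin 0"
      using nz(2) by (metis vimageD zcoord_xcoord)
    ultimately show ?thesis using open_vimage_xcoord[OF oV] by blast
  qed
qed

end

section \<open>From holomorphic maps to smooth fields on the sphere\<close>

text \<open>Substituting \<open>w = 1 / v\<close> in the inverse stereographic formulas gives
  \<open>n1 + i n2 = 2 * cnj v / (1 + |v|^2)\<close>, whence the minus sign in the second
  component.\<close>

fun stereo_v_inv :: "riemann_sphere \<Rightarrow> real^3" where
  "stereo_v_inv (Fin a) = vector [2 * Re a / (1 + (cmod a)\<^sup>2), - 2 * Im a / (1 + (cmod a)\<^sup>2),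
     ((cmod a)\<^sup>2 - 1) / (1 + (cmod a)\<^sup>2)]"
| "stereo_v_inv Infty = vector [0, 0, 1]"

lemma stereo_v_inv_unit:
  "(stereo_v_inv a $ 1)\<^sup>2 + (stereo_v_inv a $ 2)\<^sup>2 + (stereo_v_inv a $ 3)\<^sup>2 = 1"
proof (cases a)
  case (Fin b)
  have "1 + (Re b)\<^sup>2 + (Im b)\<^sup>2 > 0" by (simp add: add_pos_nonneg)
  then show ?thesis
    by (simp add: Fin cmod_power2 power_divide add_divide_distrib[symmetric] divide_eq_1_iff)
      (simp add: algebra_simps power2_eq_square)
qed simp

text \<open>The point with homogeneous coordinates \<open>[p : q]\<close>.\<close>

definition sphere_ratio :: "complex \<Rightarrow> complex \<Rightarrow> riemann_sphere" where
  "sphere_ratio p q = (if q = 0 then Infty else Fin (p / q))"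

text \<open>In homogeneous coordinates the formulas need no case distinction at
  \<open>q = 0\<close>: the denominator is \<open>|p|^2 + |q|^2\<close>, which is nonzero for an
  admissible pair. This makes smoothness across the poles of \<open>v\<close> visible.\<close>

lemma stereo_v_inv_ratio:
  assumes "p \<noteq> 0 \<or> q \<noteq> 0"
  shows "planar (stereo_v_inv (sphere_ratio p q)) = 2 * (cnj p * q) * inverse (p * cnj p + q * cnj q)"
    "of_real (stereo_v_inv (sphere_ratio p q) $ 3)
      = (p * cnj p + - (q * cnj q)) * inverse (p * cnj p + q * cnj q)"
proof -
  show "planar (stereo_v_inv (sphere_ratio p q)) = 2 * (cnj p * q) * inverse (p * cnj p + q * cnj q)"
  proof (cases "q = 0")
    case False
    define a where "a = p / q"
    have p: "p = a * q" using False by (simp add: a_def)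
    have "planar (stereo_v_inv (sphere_ratio p q)) = of_real (2 / (1 + (cmod a)\<^sup>2)) * cnj a"
    proof -
      have "planar (stereo_v_inv (Fin a)) = of_real (2 / (1 + (cmod a)\<^sup>2)) * cnj a"
        by (simp add: planar_def complex_eq_iff)
      then show ?thesis using False by (simp add: sphere_ratio_def flip: a_def)
    qed
    also have "\<dots> = 2 * cnj a / (1 + a * cnj a)"
      by (simp add: complex_norm_square[symmetric] flip: of_real_power)
    also have "\<dots> = 2 * cnj a * (q * cnj q) / ((1 + a * cnj a) * (q * cnj q))"
      using False by simp
    also have "\<dots> = 2 * (cnj p * q) * inverse (p * cnj p + q * cnj q)"
      by (simp add: p divide_inverse algebra_simps)
    finally show ?thesis .
  qed (simp add: sphere_ratio_def planar_def complex_eq_iff)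
  show "of_real (stereo_v_inv (sphere_ratio p q) $ 3)
      = (p * cnj p + - (q * cnj q)) * inverse (p * cnj p + q * cnj q)"
  proof (cases "q = 0")
    case False
    define a where "a = p / q"
    have p: "p = a * q" using False by (simp add: a_def)
    have "complex_of_real (stereo_v_inv (sphere_ratio p q) $ 3) = (a * cnj a - 1) / (1 + a * cnj a)"
      using False by (simp add: sphere_ratio_def a_def[symmetric] complex_norm_square[symmetric]
         flip: of_real_power)
    also have "\<dots> = (a * cnj a - 1) * (q * cnj q) / ((1 + a * cnj a) * (q * cnj q))"
      using False by simp
    also have "\<dots> = (p * cnj p + - (q * cnj q)) * inverse (p * cnj p + q * cnj q)"
      by (simp add: p divide_inverse algebra_simps)
    finally show ?thesis .
  qed (use assms in \<open>simp add: sphere_ratio_def field_simps\<close>)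
qed

text \<open>For a finite value \<open>b\<close> put \<open>r = 1 + |b|^2\<close>. The height
  satisfies \<open>1 - n3 = 2 / r\<close> and the planar part is \<open>2 * cnj b / r\<close>, so
  the chart formula for \<open>v\<close> returns \<open>b\<close>.\<close>

lemma stereo_v_stereo_v_inv: "stereo_v (stereo_v_inv a) = a"
proof (cases a)
  case Infty
  then show ?thesis
    using stereo_v_eq_Infty_iff[OF stereo_v_inv_unit, of a] by simp
next
  case (Fin b)
  define r where "r = 1 + (cmod b)\<^sup>2"
  have r: "r > 0" by (simp add: r_def add_pos_nonneg)
  have h: "stereo_v_inv a $ 3 = 1 - 2 / r"
    using r by (simp add: Fin r_def field_simps)
  have pl: "planar (stereo_v_inv a) = of_real (2 / r) * cnj b"
    by (simp add: Fin planar_def complex_eq_iff flip: r_def)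
  have "stereo_v (stereo_v_inv a) \<noteq> Infty"
    unfolding stereo_v_eq_Infty_iff[OF stereo_v_inv_unit] using h r by simp
  moreover have "fin_part (stereo_v (stereo_v_inv a)) = b"
    unfolding fin_part_stereo_v[OF stereo_v_inv_unit] using r by (simp add: h pl)
  ultimately show ?thesis
    by (cases "stereo_v (stereo_v_inv a)") (auto simp: Fin)
qed

lemma sphere_field_ratio:
  assumes "\<And>x. \<exists>U p q. open U \<and> x \<in> U \<and> C2_on U p \<and> C2_on U q \<and>
    (\<forall>y\<in>U. (p y \<noteq> 0 \<or> q y \<noteq> 0) \<and> v y = sphere_ratio (p y) (q y))"
  shows "sphere_field (\<lambda>x. stereo_v_inv (v x))"
proof -
  let ?m = "\<lambda>x. stereo_v_inv (v x)"
  have loc: "\<exists>U. open U \<and> x \<in> U \<and> C2_on U (\<lambda>x. planar (?m x))"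
    "\<exists>U. open U \<and> x \<in> U \<and> C2_on U (\<lambda>x. of_real (?m x $ 3))" for x
  proof -
    obtain U p q where U: "open U" "x \<in> U" "C2_on U p" "C2_on U q"
      and pq: "\<And>y. y \<in> U \<Longrightarrow> p y \<noteq> 0 \<or> q y \<noteq> 0" "\<And>y. y \<in> U \<Longrightarrow> v y = sphere_ratio (p y) (q y)"
      using assms[of x] by blast
    have nz: "p y * cnj (p y) + q y * cnj (q y) \<noteq> 0" if "y \<in> U" for y
    proof -
      have "p y * cnj (p y) + q y * cnj (q y) = of_real ((cmod (p y))\<^sup>2 + (cmod (q y))\<^sup>2)"
        by (simp only: of_real_add complex_norm_square)
      moreover have "(cmod (p y))\<^sup>2 + (cmod (q y))\<^sup>2 \<noteq> 0"
        using pq(1)[OF that] by (auto simp: sum_power2_eq_zero_iff)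
      ultimately show ?thesis by (simp only: of_real_eq_0_iff not_False_eq_True)
    qed
    have c2: "C2_on U (\<lambda>y. 2 * (cnj (p y) * q y) * inverse (p y * cnj (p y) + q y * cnj (q y)))"
      "C2_on U (\<lambda>y. (p y * cnj (p y) + - (q y * cnj (q y))) * inverse (p y * cnj (p y) + q y * cnj (q y)))"
      using U nz by (intro C2_on_mult C2_on_const C2_on_cnj C2_on_inverse C2_on_add C2_on_minus; simp)+
    have eq: "2 * (cnj (p y) * q y) * inverse (p y * cnj (p y) + q y * cnj (q y)) = planar (?m y)"
      "(p y * cnj (p y) + - (q y * cnj (q y))) * inverse (p y * cnj (p y) + q y * cnj (q y))
        = of_real (?m y $ 3)" if "y \<in> U" for y
      by (simp_all only: pq(2)[OF that] stereo_v_inv_ratio[OF pq(1)[OF that]])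
    have "C2_on U (\<lambda>x. planar (?m x))" "C2_on U (\<lambda>x. of_real (?m x $ 3))"
      by (rule C2_on_cong[OF c2(1) U(1) eq(1)], assumption)
        (rule C2_on_cong[OF c2(2) U(1) eq(2)], assumption)
    then show "\<exists>U. open U \<and> x \<in> U \<and> C2_on U (\<lambda>x. planar (?m x))"
      "\<exists>U. open U \<and> x \<in> U \<and> C2_on U (\<lambda>x. of_real (?m x $ 3))"
      using U by blast+
  qed
  \<comment> \<open>These maps reassemble the field from its planar part and its height, both
    treated as complex functions so far.\<close>
  define L1 L2 :: "complex \<Rightarrow> real^3" where "L1 a = vector [Re a, Im a, 0]" and "L2 a = vector [0, 0, Re a]" for a
  have L: "bounded_linear L1" "bounded_linear L2"
    by (auto intro!: linear_conv_bounded_linear[THEN iffD1] linearI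
        simp: L1_def L2_def vec_eq_iff forall_3 vector_3)
  have "twice_cont_diff (\<lambda>x. L1 (planar (?m x)) + L2 (of_real (?m x $ 3)))"
    using twice_cont_diff_complex[OF C2_on_local[OF loc(1)]] twice_cont_diff_complex[OF C2_on_local[OF loc(2)]]
    by (rule twice_cont_diff_add[OF twice_cont_diff_bounded_linear[OF L(1)] twice_cont_diff_bounded_linear[OF L(2)]])
  moreover have "(\<lambda>x. L1 (planar (?m x)) + L2 (of_real (?m x $ 3))) = ?m"
    by (simp add: fun_eq_iff L1_def L2_def planar_def vec_eq_iff forall_3 vector_3)
  ultimately show ?thesis
    by (simp add: sphere_field_def stereo_v_inv_unit)
qed

text \<open>The definition may offer the chart \<open>1 / f\<close> even where \<open>f\<close> is
  finite. On the open set where \<open>1 / f\<close> is nonzero it can be inverted.\<close>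

lemma sphere_holomorphic_finite:
  assumes "sphere_holomorphic f" "f z \<noteq> Infty"
  obtains U where "open U" "z \<in> U" "\<And>u. u \<in> U \<Longrightarrow> f u \<noteq> Infty" "(\<lambda>u. fin_part (f u)) holomorphic_on U"
proof -
  obtain U where U: "open U" "z \<in> U" and
    "(\<forall>u\<in>U. f u \<noteq> Infty) \<and> (\<lambda>u. fin_part (f u)) holomorphic_on U \<or>
     (\<forall>u\<in>U. f u \<noteq> Fin 0) \<and> (\<lambda>u. fin_part (sphere_inverse (f u))) holomorphic_on U"
    using assms(1) unfolding sphere_holomorphic_def by blast
  then consider "(\<forall>u\<in>U. f u \<noteq> Infty)" "(\<lambda>u. fin_part (f u)) holomorphic_on U"
    | "\<forall>u\<in>U. f u \<noteq> Fin 0" "(\<lambda>u. fin_part (sphere_inverse (f u))) holomorphic_on U" by blast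
  then show thesis
  proof cases
    case 2
    let ?g = "\<lambda>u. fin_part (sphere_inverse (f u))"
    define V where "V = U \<inter> ?g -` (- {0})"
    have "open V" unfolding V_def
      using 2 U by (intro continuous_open_preimage holomorphic_on_imp_continuous_on) auto
    moreover have "z \<in> V"
      using U 2 assms(2) unfolding V_def by (cases "f z") auto
    moreover have "f u \<noteq> Infty" if "u \<in> V" for u
      using that by (auto simp: V_def)
    moreover have "(\<lambda>u. inverse (?g u)) holomorphic_on V"
      using 2 by (intro holomorphic_intros) (auto simp: V_def elim: holomorphic_on_subset)
    ultimately show ?thesis
      by (intro that[of V]) (auto simp: fin_part_sphere_inverse)
  qed (use that U in blast)
qed

lemma sphere_holomorphic_infinite:
  assumes "sphere_holomorphic f" "f z = Infty"
  obtains U where "open U" "z \<in> U" "\<And>u. u \<in> U \<Longrightarrow> f u \<noteq> Fin 0"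
    "(\<lambda>u. fin_part (sphere_inverse (f u))) holomorphic_on U"
  using assms unfolding sphere_holomorphic_def by (metis (no_types, lifting))

text \<open>Where \<open>f\<close> is finite, the translated map is the ratio of
  \<open>c * cnj z + f\<close> and \<open>1\<close>. Near a pole, with \<open>g = 1 / f\<close>, it
  is the ratio of \<open>1 + c * cnj z * g\<close> and \<open>g\<close>, which have no common zero
  because the first is \<open>1\<close> where \<open>g = 0\<close>.\<close>

lemma sphere_field_translate:
  assumes f: "sphere_holomorphic f"
  shows "sphere_field (\<lambda>x. stereo_v_inv (sphere_translate (c * cnj (zcoord x)) (f (zcoord x))))"
proof (rule sphere_field_ratio)
  fix x :: "real^2"
  let ?v = "\<lambda>x. sphere_translate (c * cnj (zcoord x)) (f (zcoord x))"
  show "\<exists>U p q. open U \<and> x \<in> U \<and> C2_on U p \<and> C2_on U q \<and>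
    (\<forall>y\<in>U. (p y \<noteq> 0 \<or> q y \<noteq> 0) \<and> ?v y = sphere_ratio (p y) (q y))"
  proof (cases "f (zcoord x) = Infty")
    case False
    then obtain U where U: "open U" "zcoord x \<in> U" "\<And>u. u \<in> U \<Longrightarrow> f u \<noteq> Infty"
      "(\<lambda>u. fin_part (f u)) holomorphic_on U"
      using sphere_holomorphic_finite[OF f] by blast
    note o = open_vimage_zcoord[OF U(1)]
    let ?p = "\<lambda>x. c * cnj (zcoord x) + fin_part (f (zcoord x))"
    have "?v y = sphere_ratio (?p y) 1" if "y \<in> zcoord -` U" for y
      using that U(3)[of "zcoord y"] by (cases "f (zcoord y)") (auto simp: sphere_ratio_def)
    moreover have "C2_on (zcoord -` U) ?p"
      by (intro C2_on_add C2_on_mult C2_on_const C2_on_cnj_zcoord C2_on_holomorphic U o)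
    moreover have "C2_on (zcoord -` U) (\<lambda>y. 1)" by (rule C2_on_const[OF o])
    ultimately show ?thesis
      using o U(2) by (intro exI[of _ "zcoord -` U"] exI[of _ ?p] exI[of _ "\<lambda>y. 1"]) auto
  next
    case True
    then obtain U where U: "open U" "zcoord x \<in> U" "\<And>u. u \<in> U \<Longrightarrow> f u \<noteq> Fin 0"
      "(\<lambda>u. fin_part (sphere_inverse (f u))) holomorphic_on U"
      using sphere_holomorphic_infinite[OF f] by blast
    note o = open_vimage_zcoord[OF U(1)]
    let ?q = "\<lambda>x. fin_part (sphere_inverse (f (zcoord x)))"
    let ?p = "\<lambda>x. 1 + (c * cnj (zcoord x)) * ?q x"
    have "?v y = sphere_ratio (?p y) (?q y)" if "y \<in> zcoord -` U" for y
      using that U(3)[of "zcoord y"] by (cases "f (zcoord y)") (auto simp: sphere_ratio_def field_simps)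
    moreover have q: "C2_on (zcoord -` U) ?q"
      by (rule C2_on_holomorphic[OF U(1,4)])
    moreover have "C2_on (zcoord -` U) ?p"
      by (intro C2_on_add C2_on_mult C2_on_const C2_on_cnj_zcoord q o)
    moreover have "?p y \<noteq> 0 \<or> ?q y \<noteq> 0" for y by auto
    ultimately show ?thesis
      using o U(2) by (intro exI[of _ "zcoord -` U"] exI[of _ ?p] exI[of _ ?q]) auto
  qed
qed

text \<open>Where \<open>f\<close> is finite, its holomorphic part has no \<open>dzbar\<close>
  derivative and \<open>c * cnj z\<close> contributes \<open>c\<close>. At a pole,
  \<open>1 / v = g / (1 + c * cnj z * g)\<close> with \<open>g = 1 / f\<close> holomorphic and zero,
  so both sides of the equation in \<open>w\<close> vanish.\<close>

lemma bogomolnyi_translate: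
  assumes f: "sphere_holomorphic f"
  shows "bogomolnyi \<kappa> \<alpha> (\<lambda>x. sphere_translate
     (- (\<i> / 2) * of_real \<kappa> * exp (\<i> * of_real \<alpha>) * cnj (zcoord x)) (f (zcoord x)))"
proof -
  define c where "c = - (\<i> / 2) * of_real \<kappa> * exp (\<i> * of_real \<alpha>)"
  let ?v = "\<lambda>x. sphere_translate (c * cnj (zcoord x)) (f (zcoord x))"
  have cz: "has_wirtinger (\<lambda>x. c * cnj (zcoord x)) 0 c x" for x
    using has_wirtinger_mult[OF has_wirtinger_const[of c x] has_wirtinger_cnj_zcoord] by simp
  have "if ?v x \<noteq> Infty then dzbar (\<lambda>y. fin_part (?v y)) x = c
    else dzbar (\<lambda>y. fin_part (sphere_inverse (?v y))) x = - c * (fin_part (sphere_inverse (?v x)))\<^sup>2" for x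
  proof (cases "f (zcoord x) = Infty")
    case False
    then obtain U where U: "open U" "zcoord x \<in> U" "\<And>u. u \<in> U \<Longrightarrow> f u \<noteq> Infty"
      "(\<lambda>u. fin_part (f u)) holomorphic_on U"
      using sphere_holomorphic_finite[OF f] by blast
    have "has_wirtinger (\<lambda>y. c * cnj (zcoord y) + fin_part (f (zcoord y)))
        (0 + deriv (\<lambda>u. fin_part (f u)) (zcoord x)) (c + 0) x"
      using U by (intro has_wirtinger_add cz has_wirtinger_zcoord_compose holomorphic_derivI)
    then have "has_wirtinger (\<lambda>y. fin_part (?v y)) (0 + deriv (\<lambda>u. fin_part (f u)) (zcoord x)) (c + 0) x"
      by (rule has_wirtinger_cong[OF _ open_vimage_zcoord[OF U(1)]])
        (use U in \<open>auto simp: fin_part_sphere_translate\<close>)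
    then show ?thesis using False has_wirtinger_dz(2) by fastforce
  next
    case True
    then obtain U where U: "open U" "zcoord x \<in> U" "\<And>u. u \<in> U \<Longrightarrow> f u \<noteq> Fin 0"
      "(\<lambda>u. fin_part (sphere_inverse (f u))) holomorphic_on U"
      using sphere_holomorphic_infinite[OF f] by blast
    let ?g = "\<lambda>y. fin_part (sphere_inverse (f (zcoord y)))"
    have gx: "?g x = 0" using True by simp
    have g: "has_wirtinger ?g (deriv (\<lambda>u. fin_part (sphere_inverse (f u))) (zcoord x)) 0 x"
      using U by (intro has_wirtinger_zcoord_compose holomorphic_derivI)
    \<comment> \<open>In the product rule \<open>A\<close> and \<open>B\<close> are multiplied by
      \<open>?g x = 0\<close>, so their values need not be computed.\<close>
    obtain A B where d: "has_wirtinger (\<lambda>y. inverse (1 + (c * cnj (zcoord y)) * ?g y)) A B x"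
      using has_wirtinger_inverse[OF has_wirtinger_add[OF
          has_wirtinger_const[of 1] has_wirtinger_mult[OF cz g]]] gx by fastforce
    have "has_wirtinger (\<lambda>y. fin_part (sphere_inverse (?v y)))
       (deriv (\<lambda>u. fin_part (sphere_inverse (f u))) (zcoord x) * inverse (1 + (c * cnj (zcoord x)) * ?g x) + ?g x * A)
       (0 * inverse (1 + (c * cnj (zcoord x)) * ?g x) + ?g x * B) x"
      by (rule has_wirtinger_cong[OF has_wirtinger_mult[OF g d] open_vimage_zcoord[OF U(1)]])
        (use U in \<open>auto simp: fin_part_inverse_translate\<close>)
    from has_wirtinger_dz(2)[OF this] show ?thesis using True gx by simp
  qed
  moreover have "\<i> / 2 * of_real \<kappa> * exp (\<i> * of_real \<alpha>) = - c" by (simp add: c_def)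
  ultimately show ?thesis
    unfolding bogomolnyi_def Let_def c_def[symmetric] by simp
qed

section \<open>The energy identity, its equality case and the general solution\<close>

theorem theorem4p1:
  fixes \<kappa> \<alpha> :: real and n :: "real^2 \<Rightarrow> real^3"
  assumes "\<kappa> > 0" and "0 \<le> \<alpha>" and "\<alpha> < 2 * pi"
    and "sphere_field n"
  shows
    "(\<forall>D. compact D \<longrightarrow>
        complex_of_real (energy \<kappa> \<alpha> D n) =
          complex_of_real (4 * pi * (charge D n + vorticity \<kappa> \<alpha> D n)) +
          (LINT x:D|lborel. remainder_density \<kappa> \<alpha> (\<lambda>y. stereo_w (n y)) x)) \<and>
     ((\<forall>D. compact D \<longrightarrow> energy \<kappa> \<alpha> D n = 4 * pi * (charge D n + vorticity \<kappa> \<alpha> D n))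
        \<longleftrightarrow> bogomolnyi \<kappa> \<alpha> (\<lambda>y. stereo_v (n y))) \<and>
     (\<forall>v :: real^2 \<Rightarrow> riemann_sphere.
        (\<exists>m. sphere_field m \<and> v = (\<lambda>x. stereo_v (m x))) \<and> bogomolnyi \<kappa> \<alpha> v
        \<longleftrightarrow>
        (\<exists>f. sphere_holomorphic f \<and>
          (\<forall>x. v x = sphere_translate
             (- (\<i> / 2) * of_real \<kappa> * exp (\<i> * of_real \<alpha>) * cnj (zcoord x)) (f (zcoord x)))))"
proof (intro conjI allI impI)
  note n = \<open>sphere_field n\<close>
  fix D :: "(real^2) set" assume "compact D"
  then show "complex_of_real (energy \<kappa> \<alpha> D n) =
          complex_of_real (4 * pi * (charge D n + vorticity \<kappa> \<alpha> D n)) +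
          (LINT x:D|lborel. remainder_density \<kappa> \<alpha> (\<lambda>y. stereo_w (n y)) x)"
    unfolding remainder_density_eq[OF n] set_integral_complex_of_real energy_decompose[OF n \<open>compact D\<close>]
    by simp
next
  note n = \<open>sphere_field n\<close>
  have "(\<forall>D. compact D \<longrightarrow> energy \<kappa> \<alpha> D n = 4 * pi * (charge D n + vorticity \<kappa> \<alpha> D n))
    \<longleftrightarrow> (\<forall>D. compact D \<longrightarrow> (LINT x:D|lborel. stereo_remainder \<kappa> \<alpha> n x) = 0)"
    using energy_decompose[OF n] by auto
  also have "\<dots> \<longleftrightarrow> (\<forall>x. stereo_remainder \<kappa> \<alpha> n x = 0)"
    using continuous_nonneg_integral_zero[OF continuous_densities(4)[OF n] stereo_remainder_nonneg]
    by (auto simp: set_lebesgue_integral_def)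
  finally show "(\<forall>D. compact D \<longrightarrow> energy \<kappa> \<alpha> D n = 4 * pi * (charge D n + vorticity \<kappa> \<alpha> D n))
        \<longleftrightarrow> bogomolnyi \<kappa> \<alpha> (\<lambda>y. stereo_v (n y))"
    by (simp add: bogomolnyi_iff_remainder[OF n])
next
  fix v :: "real^2 \<Rightarrow> riemann_sphere"
  let ?c = "- (\<i> / 2) * of_real \<kappa> * exp (\<i> * of_real \<alpha>)"
  show "(\<exists>m. sphere_field m \<and> v = (\<lambda>x. stereo_v (m x))) \<and> bogomolnyi \<kappa> \<alpha> v
        \<longleftrightarrow>
        (\<exists>f. sphere_holomorphic f \<and>
          (\<forall>x. v x = sphere_translate (?c * cnj (zcoord x)) (f (zcoord x))))"
  proof (intro iffI; elim conjE exE)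
    fix m assume m: "sphere_field m" and v: "v = (\<lambda>x. stereo_v (m x))" and b: "bogomolnyi \<kappa> \<alpha> v"
    show "\<exists>f. sphere_holomorphic f \<and>
        (\<forall>x. v x = sphere_translate (?c * cnj (zcoord x)) (f (zcoord x)))"
    proof (intro exI conjI allI)
      \<comment> \<open>The witness is \<open>v\<close> with the antiholomorphic part subtracted;
        translating back restores \<open>v\<close>.\<close>
      show "sphere_holomorphic (\<lambda>z. sphere_translate (- ?c * cnj z) (stereo_v (m (xcoord z))))"
        by (rule bogomolnyi_imp_translate[OF m b[unfolded v]])
    qed (simp add: v sphere_translate_translate)
  next
    fix f assume f: "sphere_holomorphic f"
      and v: "\<forall>x. v x = sphere_translate (?c * cnj (zcoord x)) (f (zcoord x))"
    then have v': "v = (\<lambda>x. sphere_translate (?c * cnj (zcoord x)) (f (zcoord x)))" by blast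
    \<comment> \<open>The field required for \<open>v\<close> is the inverse stereographic image of
      \<open>v\<close> itself.\<close>
    have "v = (\<lambda>x. stereo_v (stereo_v_inv (v x)))"
      by (simp add: stereo_v_stereo_v_inv)
    moreover have "sphere_field (\<lambda>x. stereo_v_inv (v x))"
      unfolding v' by (rule sphere_field_translate[OF f])
    ultimately show "(\<exists>m. sphere_field m \<and> v = (\<lambda>x. stereo_v (m x))) \<and> bogomolnyi \<kappa> \<alpha> v"
      using bogomolnyi_translate[OF f] v' by metis
  qed
qed

end
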